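(* Let $\mathcal{G}$ be a groupoid and let $R$ be a $\mathcal{G}$-graded ring which is object unital, with $1_{R_e}\neq0$ for all $e\in\mathcal{G}_0$. Then $R$ is (isomorphic as a $\mathcal{G}$-graded ring to) an object twisted groupoid ring if and only if the following conditions hold: (i) all the rings $R_e$, for $e\in\mathcal{G}_0$, are copies of the same ring $B$ (the copy of an element $b\in B$ in $R_e$ is denoted by $b^e$); (ii) for all $\sigma\in\mathcal{G}$ there is an object invertible element $u_\sigma\in R_\sigma$ with the property that for all $b\in B$ the equality $b^{r(\sigma)}u_\sigma=u_\sigma b^{d(\sigma)}$ holds.
   Context: Rings are associative but not necessarily unital. A groupoid $\mathcal{G}$ is a small category in which every morphism is an isomorphism, identified with its set of morphisms; $d(\sigma)=\sigma^{-1}\sigma$, $r(\sigma)=\sigma\sigma^{-1}$; $\mathcal{G}_0$ is the set of identity elements; $\sigma\tau$ is defined iff $d(\sigma)=r(\tau)$; $\mathcal{G}_2$, $\mathcal{G}_3$ are the sets of composable pairs and triples. A ring $R$ is $\mathcal{G}$-graded if $R=\bigoplus_{\sigma\in\mathcal{G}}R_\sigma$ for additive subgroups $R_\sigma$ with $R_\sigma R_\tau\subseteq R_{\sigma\tau}$ if $(\sigma,\tau)\in\mathcal{G}_2$ and $R_\sigma R_\tau=\{0\}$ otherwise. It is object unital if each ring $R_e$, $e\in\mathcal{G}_0$, is unital and $1_{R_{r(\sigma)}}x=x1_{R_{d(\sigma)}}=x$ for all $\sigma\in\mathcal{G}$, $x\in R_\sigma$. An element $x\in R_\sigma$ is object invertible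 if there is $y\in R_{\sigma^{-1}}$ with $xy=1_{R_{r(\sigma)}}$ and $yx=1_{R_{d(\sigma)}}$. "Copies of the same ring $B$" means that there are a unital ring $B$ and ring isomorphisms $B\to R_e$, $b\mapsto b^e$, for $e\in\mathcal{G}_0$; condition (ii) refers to these isomorphisms. An object twisted groupoid ring $B\rtimes_\beta\mathcal{G}$ is given by a non-zero unital ring $B$ and elements $\beta_{\sigma,\tau}\in U(Z(B))$ for $(\sigma,\tau)\in\mathcal{G}_2$ (units of the center of $B$) with $\beta_{\sigma,d(\sigma)}=\beta_{r(\sigma),\sigma}=1_B$ for all $\sigma\in\mathcal{G}$ and $\beta_{\sigma,\tau}\beta_{\sigma\tau,\rho}=\beta_{\tau,\rho}\beta_{\sigma,\tau\rho}$ for all $(\sigma,\tau,\rho)\in\mathcal{G}_3$ (i.e. it is the object crossed product of an object crossed system with all $A_e=B$ and all $\alpha_\sigma=\mathrm{id}_B$): it consists of formal sums $\sum_\sigma b_\sigma u_\sigma$, $b_\sigma\in B$ almost all zero, with product the additive extension of $bu_\sigma\cdot b'u_\tau=bb'\beta_{\sigma,\tau}u_{\sigma\tau}$ if $(\sigma,\tau)\in\mathcal{G}_2$ and $0$ otherwise, graded by $Bu_\sigma$ in degree $\sigma$. *)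

theory Defs
  imports "HOL-Algebra.QuotRing"
begin

section \<open>Groupoids\<close>

text \<open>
  Small categories are given by their morphisms alone: the carrier is the set of morphisms, and
  an object is identified with its identity morphism. The values of \<open>source\<close>, \<open>target\<close> and
  \<open>comp\<close> matter only on morphisms and on composable pairs, respectively.
\<close>

record 'g category_struct = "'g partial_object" +
  source :: "'g \<Rightarrow> 'g"
  target :: "'g \<Rightarrow> 'g"
  comp :: "'g \<Rightarrow> 'g \<Rightarrow> 'g"  (infixl \<open>\<cdot>\<index>\<close> 70)

locale small_category =
  fixes G :: "('g, 'm) category_struct_scheme" (structure)
  assumes source_closed: "\<sigma> \<in> carrier G \<Longrightarrow> source G \<sigma> \<in> carrier G"
    and target_closed: "\<sigma> \<in> carrier G \<Longrightarrow> target G \<sigma> \<in> carrier G"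
    and source_source: "\<sigma> \<in> carrier G \<Longrightarrow> source G (source G \<sigma>) = source G \<sigma>"
    and target_source: "\<sigma> \<in> carrier G \<Longrightarrow> target G (source G \<sigma>) = source G \<sigma>"
    and source_target: "\<sigma> \<in> carrier G \<Longrightarrow> source G (target G \<sigma>) = target G \<sigma>"
    and target_target: "\<sigma> \<in> carrier G \<Longrightarrow> target G (target G \<sigma>) = target G \<sigma>"
    and comp_closed: "\<lbrakk>\<sigma> \<in> carrier G; \<tau> \<in> carrier G; source G \<sigma> = target G \<tau>\<rbrakk>
      \<Longrightarrow> \<sigma> \<cdot> \<tau> \<in> carrier G"
    and source_comp: "\<lbrakk>\<sigma> \<in> carrier G; \<tau> \<in> carrier G; source G \<sigma> = target G \<tau>\<rbrakk>
      \<Longrightarrow> source G (\<sigma> \<cdot> \<tau>) = source G \<tau>"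
    and target_comp: "\<lbrakk>\<sigma> \<in> carrier G; \<tau> \<in> carrier G; source G \<sigma> = target G \<tau>\<rbrakk>
      \<Longrightarrow> target G (\<sigma> \<cdot> \<tau>) = target G \<sigma>"
    and comp_source: "\<sigma> \<in> carrier G \<Longrightarrow> \<sigma> \<cdot> source G \<sigma> = \<sigma>"
    and target_comp_self: "\<sigma> \<in> carrier G \<Longrightarrow> target G \<sigma> \<cdot> \<sigma> = \<sigma>"
    and comp_assoc: "\<lbrakk>\<sigma> \<in> carrier G; \<tau> \<in> carrier G; \<rho> \<in> carrier G;
        source G \<sigma> = target G \<tau>; source G \<tau> = target G \<rho>\<rbrakk>
      \<Longrightarrow> (\<sigma> \<cdot> \<tau>) \<cdot> \<rho> = \<sigma> \<cdot> (\<tau> \<cdot> \<rho>)"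

definition objects :: "('g, 'm) category_struct_scheme \<Rightarrow> 'g set" where
  "objects G = {e \<in> carrier G. source G e = e}"

definition composable :: "('g, 'm) category_struct_scheme \<Rightarrow> 'g \<Rightarrow> 'g \<Rightarrow> bool" where
  "composable G \<sigma> \<tau> \<longleftrightarrow> \<sigma> \<in> carrier G \<and> \<tau> \<in> carrier G \<and> source G \<sigma> = target G \<tau>"

definition inverse_of :: "('g, 'm) category_struct_scheme \<Rightarrow> 'g \<Rightarrow> 'g \<Rightarrow> bool" where
  "inverse_of G \<sigma> \<tau> \<longleftrightarrow> composable G \<sigma> \<tau> \<and> composable G \<tau> \<sigma> \<and>
     \<sigma> \<cdot>\<^bsub>G\<^esub> \<tau> = target G \<sigma> \<and> \<tau> \<cdot>\<^bsub>G\<^esub> \<sigma> = source G \<sigma>"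

definition ginv :: "('g, 'm) category_struct_scheme \<Rightarrow> 'g \<Rightarrow> 'g" where
  "ginv G \<sigma> = (THE \<tau>. inverse_of G \<sigma> \<tau>)"

locale groupoid = small_category +
  assumes ex_inverse: "\<sigma> \<in> carrier G \<Longrightarrow> \<exists>\<tau>. inverse_of G \<sigma> \<tau>"
begin

lemma inverse_of_unique:
  assumes "inverse_of G \<sigma> \<tau>" "inverse_of G \<sigma> \<tau>'"
  shows "\<tau> = \<tau>'"
proof -
  have c: "\<sigma> \<in> carrier G" "\<tau> \<in> carrier G" "\<tau>' \<in> carrier G"
    and s: "source G \<sigma> = target G \<tau>" "source G \<tau> = target G \<sigma>"
      "source G \<sigma> = target G \<tau>'" "source G \<tau>' = target G \<sigma>"
    and i: "\<sigma> \<cdot> \<tau>' = target G \<sigma>" "\<tau> \<cdot> \<sigma> = source G \<sigma>"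
    using assms unfolding inverse_of_def composable_def by auto
  have "\<tau> = \<tau> \<cdot> source G \<tau>"
    using c comp_source by simp
  also have "\<dots> = \<tau> \<cdot> (\<sigma> \<cdot> \<tau>')"
    using s i by simp
  also have "\<dots> = (\<tau> \<cdot> \<sigma>) \<cdot> \<tau>'"
    using c s comp_assoc by simp
  also have "\<dots> = target G \<tau>' \<cdot> \<tau>'"
    using s i by simp
  also have "\<dots> = \<tau>'"
    using c target_comp_self by simp
  finally show ?thesis .
qed

lemma inverse_of_ginv: "\<sigma> \<in> carrier G \<Longrightarrow> inverse_of G \<sigma> (ginv G \<sigma>)"
  unfolding ginv_def using ex_inverse inverse_of_unique by (metis theI)

lemma source_eq: "\<sigma> \<in> carrier G \<Longrightarrow> source G \<sigma> = ginv G \<sigma> \<cdot> \<sigma>"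
  and target_eq: "\<sigma> \<in> carrier G \<Longrightarrow> target G \<sigma> = \<sigma> \<cdot> ginv G \<sigma>"
  using inverse_of_ginv unfolding inverse_of_def by auto

end


section \<open>Graded rings that need not be unital\<close>

text \<open>
  Rings without unit are \<open>ring\<close> records as well; their \<open>one\<close> field is never used.
\<close>

locale nonunital_ring = abelian_group R for R (structure) +
  assumes m_closed: "\<lbrakk>x \<in> carrier R; y \<in> carrier R\<rbrakk> \<Longrightarrow> x \<otimes> y \<in> carrier R"
    and m_assoc: "\<lbrakk>x \<in> carrier R; y \<in> carrier R; z \<in> carrier R\<rbrakk>
      \<Longrightarrow> (x \<otimes> y) \<otimes> z = x \<otimes> (y \<otimes> z)"
    and l_distr: "\<lbrakk>x \<in> carrier R; y \<in> carrier R; z \<in> carrier R\<rbrakk>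
      \<Longrightarrow> (x \<oplus> y) \<otimes> z = x \<otimes> z \<oplus> y \<otimes> z"
    and r_distr: "\<lbrakk>x \<in> carrier R; y \<in> carrier R; z \<in> carrier R\<rbrakk>
      \<Longrightarrow> z \<otimes> (x \<oplus> y) = z \<otimes> x \<oplus> z \<otimes> y"

definition support :: "('b, 'n) ring_scheme \<Rightarrow> 'g set \<Rightarrow> ('g \<Rightarrow> 'b) \<Rightarrow> 'g set" where
  "support R I f = {\<sigma> \<in> I. f \<sigma> \<noteq> \<zero>\<^bsub>R\<^esub>}"

locale graded_ring = groupoid G + nonunital_ring R
  for G :: "('g, 'm) category_struct_scheme" (structure)
    and R :: "('r, 'n) ring_scheme" (structure) +
  fixes Rg :: "'g \<Rightarrow> 'r set"
  assumes component: "\<sigma> \<in> carrier G \<Longrightarrow> additive_subgroup (Rg \<sigma>) R"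
    and direct_sum: "x \<in> carrier R \<Longrightarrow>
      \<exists>!f. f \<in> (\<Pi>\<^sub>E \<sigma>\<in>carrier G. Rg \<sigma>) \<and> finite (support R (carrier G) f) \<and>
        x = (\<Oplus>\<^bsub>R\<^esub>\<sigma>\<in>support R (carrier G) f. f \<sigma>)"
    and mult_composable: "\<lbrakk>composable G \<sigma> \<tau>; x \<in> Rg \<sigma>; y \<in> Rg \<tau>\<rbrakk>
      \<Longrightarrow> x \<otimes>\<^bsub>R\<^esub> y \<in> Rg (\<sigma> \<cdot>\<^bsub>G\<^esub> \<tau>)"
    and mult_not_composable:
      "\<lbrakk>\<sigma> \<in> carrier G; \<tau> \<in> carrier G; \<not> composable G \<sigma> \<tau>; x \<in> Rg \<sigma>; y \<in> Rg \<tau>\<rbrakk>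
      \<Longrightarrow> x \<otimes>\<^bsub>R\<^esub> y = \<zero>\<^bsub>R\<^esub>"

definition unit_of :: "('r, 'n) ring_scheme \<Rightarrow> 'r set \<Rightarrow> 'r" where
  "unit_of R A = (THE u. u \<in> A \<and> (\<forall>x\<in>A. u \<otimes>\<^bsub>R\<^esub> x = x \<and> x \<otimes>\<^bsub>R\<^esub> u = x))"

definition subring_on :: "('r, 'n) ring_scheme \<Rightarrow> 'r set \<Rightarrow> ('r, 'n) ring_scheme" where
  "subring_on R A = R\<lparr>carrier := A, one := unit_of R A\<rparr>"

locale object_unital_ring = graded_ring +
  assumes unital_component: "e \<in> objects G \<Longrightarrow> ring (subring_on R (Rg e))"
    and unit_left: "\<lbrakk>\<sigma> \<in> carrier G; x \<in> Rg \<sigma>\<rbrakk>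
      \<Longrightarrow> unit_of R (Rg (target G \<sigma>)) \<otimes>\<^bsub>R\<^esub> x = x"
    and unit_right: "\<lbrakk>\<sigma> \<in> carrier G; x \<in> Rg \<sigma>\<rbrakk>
      \<Longrightarrow> x \<otimes>\<^bsub>R\<^esub> unit_of R (Rg (source G \<sigma>)) = x"

definition object_invertible ::
  "('g, 'm) category_struct_scheme \<Rightarrow> ('r, 'n) ring_scheme \<Rightarrow> ('g \<Rightarrow> 'r set) \<Rightarrow> 'g \<Rightarrow> 'r \<Rightarrow> bool"
  where
  "object_invertible G R Rg \<sigma> x \<longleftrightarrow> x \<in> Rg \<sigma> \<and>
     (\<exists>y\<in>Rg (ginv G \<sigma>). x \<otimes>\<^bsub>R\<^esub> y = unit_of R (Rg (target G \<sigma>)) \<and>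
        y \<otimes>\<^bsub>R\<^esub> x = unit_of R (Rg (source G \<sigma>)))"

text \<open>
  Not \<open>ring_iso\<close>, which would require the meaningless \<open>one\<close> fields to correspond.
\<close>

definition graded_iso ::
  "('g, 'm) category_struct_scheme \<Rightarrow> ('r, 'n) ring_scheme \<Rightarrow> ('g \<Rightarrow> 'r set) \<Rightarrow>
    ('s, 'k) ring_scheme \<Rightarrow> ('g \<Rightarrow> 's set) \<Rightarrow> ('r \<Rightarrow> 's) set" where
  "graded_iso G R Rg S Sg =
     {h \<in> iso (add_monoid R) (add_monoid S) \<inter> hom R S. \<forall>\<sigma>\<in>carrier G. h ` Rg \<sigma> = Sg \<sigma>}"


section \<open>Object twisted groupoid rings\<close>

definition ring_center :: "('b, 'n) ring_scheme \<Rightarrow> 'b set" where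
  "ring_center B = {z \<in> carrier B. \<forall>b\<in>carrier B. z \<otimes>\<^bsub>B\<^esub> b = b \<otimes>\<^bsub>B\<^esub> z}"

locale object_twist = groupoid G + ring B
  for G :: "('g, 'm) category_struct_scheme" (structure)
    and B :: "('b, 'n) ring_scheme" (structure) +
  fixes \<beta> :: "'g \<Rightarrow> 'g \<Rightarrow> 'b"
  assumes nonzero: "\<one>\<^bsub>B\<^esub> \<noteq> \<zero>\<^bsub>B\<^esub>"
    and twist_unit: "composable G \<sigma> \<tau> \<Longrightarrow> \<beta> \<sigma> \<tau> \<in> Units (B\<lparr>carrier := ring_center B\<rparr>)"
    and twist_source: "\<sigma> \<in> carrier G \<Longrightarrow> \<beta> \<sigma> (source G \<sigma>) = \<one>\<^bsub>B\<^esub>"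
    and twist_target: "\<sigma> \<in> carrier G \<Longrightarrow> \<beta> (target G \<sigma>) \<sigma> = \<one>\<^bsub>B\<^esub>"
    and twist_cocycle: "\<lbrakk>composable G \<sigma> \<tau>; composable G \<tau> \<rho>\<rbrakk>
      \<Longrightarrow> \<beta> \<sigma> \<tau> \<otimes>\<^bsub>B\<^esub> \<beta> (\<sigma> \<cdot>\<^bsub>G\<^esub> \<tau>) \<rho> = \<beta> \<tau> \<rho> \<otimes>\<^bsub>B\<^esub> \<beta> \<sigma> (\<tau> \<cdot>\<^bsub>G\<^esub> \<rho>)"

text \<open>
  The formal sum of the \<open>b\<^sub>\<sigma> u\<^sub>\<sigma>\<close> is the function \<open>\<sigma> \<mapsto> b\<^sub>\<sigma>\<close>. The coefficient of a product at
  \<open>u\<^sub>\<rho>\<close> collects the contributions of all composable pairs with composite \<open>\<rho>\<close>. In general there is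
  no unit, so the \<open>one\<close> field is left unspecified.
\<close>

definition twisted_groupoid_ring ::
  "('g, 'm) category_struct_scheme \<Rightarrow> ('b, 'n) ring_scheme \<Rightarrow> ('g \<Rightarrow> 'g \<Rightarrow> 'b) \<Rightarrow> ('g \<Rightarrow> 'b) ring"
  where
  "twisted_groupoid_ring G B \<beta> =
    \<lparr>carrier = {f \<in> carrier G \<rightarrow>\<^sub>E carrier B. finite (support B (carrier G) f)},
     mult = (\<lambda>f g. \<lambda>\<rho>\<in>carrier G.
       \<Oplus>\<^bsub>B\<^esub>p\<in>{(\<sigma>, \<tau>) \<in> support B (carrier G) f \<times> support B (carrier G) g.
                 composable G \<sigma> \<tau> \<and> \<sigma> \<cdot>\<^bsub>G\<^esub> \<tau> = \<rho>}.
         f (fst p) \<otimes>\<^bsub>B\<^esub> g (snd p) \<otimes>\<^bsub>B\<^esub> \<beta> (fst p) (snd p)),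
     one = undefined,
     zero = (\<lambda>\<rho>\<in>carrier G. \<zero>\<^bsub>B\<^esub>),
     add = (\<lambda>f g. \<lambda>\<rho>\<in>carrier G. f \<rho> \<oplus>\<^bsub>B\<^esub> g \<rho>)\<rparr>"

definition twisted_component ::
  "('g, 'm) category_struct_scheme \<Rightarrow> ('b, 'n) ring_scheme \<Rightarrow> 'g \<Rightarrow> ('g \<Rightarrow> 'b) set" where
  "twisted_component G B \<sigma> =
     {f \<in> carrier G \<rightarrow>\<^sub>E carrier B. support B (carrier G) f \<subseteq> {\<sigma>}}"

text \<open>The monomial \<open>b u\<^sub>\<sigma>\<close>, and a check of the product rule for monomials.\<close>

definition monomial ::
  "('g, 'm) category_struct_scheme \<Rightarrow> ('b, 'n) ring_scheme \<Rightarrow> 'b \<Rightarrow> 'g \<Rightarrow> 'g \<Rightarrow> 'b" where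
  "monomial G B b \<sigma> = (\<lambda>\<tau>\<in>carrier G. if \<tau> = \<sigma> then b else \<zero>\<^bsub>B\<^esub>)"

lemma (in object_twist) twist_closed:
  "composable G \<sigma> \<tau> \<Longrightarrow> \<beta> \<sigma> \<tau> \<in> carrier B"
  using twist_unit unfolding Units_def ring_center_def by auto

lemma (in object_twist) twisted_component_eq:
  assumes "\<sigma> \<in> carrier G"
  shows "twisted_component G B \<sigma> = (\<lambda>b. monomial G B b \<sigma>) ` carrier B"
proof (intro equalityI subsetI)
  fix f assume "f \<in> twisted_component G B \<sigma>"
  then have f: "f \<in> carrier G \<rightarrow>\<^sub>E carrier B" "support B (carrier G) f \<subseteq> {\<sigma>}"
    by (auto simp: twisted_component_def)
  then have "f = monomial G B (f \<sigma>) \<sigma>"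
    by (auto simp: monomial_def support_def fun_eq_iff PiE_def extensional_def)
  with f assms show "f \<in> (\<lambda>b. monomial G B b \<sigma>) ` carrier B" by blast
qed (use assms in \<open>auto simp: twisted_component_def monomial_def support_def split: if_splits\<close>)

lemma (in object_twist) monomial_mult:
  assumes G: "\<sigma> \<in> carrier G" "\<tau> \<in> carrier G" and B: "b \<in> carrier B" "c \<in> carrier B"
  shows "monomial G B b \<sigma> \<otimes>\<^bsub>twisted_groupoid_ring G B \<beta>\<^esub> monomial G B c \<tau> =
    (if composable G \<sigma> \<tau> then monomial G B (b \<otimes>\<^bsub>B\<^esub> c \<otimes>\<^bsub>B\<^esub> \<beta> \<sigma> \<tau>) (\<sigma> \<cdot>\<^bsub>G\<^esub> \<tau>)
     else \<zero>\<^bsub>twisted_groupoid_ring G B \<beta>\<^esub>)"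
proof -
  let ?P = "\<lambda>\<rho>. {(\<sigma>', \<tau>') \<in> support B (carrier G) (monomial G B b \<sigma>) \<times>
      support B (carrier G) (monomial G B c \<tau>). composable G \<sigma>' \<tau>' \<and> \<sigma>' \<cdot>\<^bsub>G\<^esub> \<tau>' = \<rho>}"
  have supp: "support B (carrier G) (monomial G B x \<kappa>) = (if x = \<zero>\<^bsub>B\<^esub> then {} else {\<kappa>})"
    if "\<kappa> \<in> carrier G" for x \<kappa>
    using that by (auto simp: support_def monomial_def)
  have P: "?P \<rho> = (if b \<noteq> \<zero>\<^bsub>B\<^esub> \<and> c \<noteq> \<zero>\<^bsub>B\<^esub> \<and> composable G \<sigma> \<tau> \<and> \<sigma> \<cdot>\<^bsub>G\<^esub> \<tau> = \<rho>
      then {(\<sigma>, \<tau>)} else {})" for \<rho>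
    using G by (auto simp: supp)
  let ?F = "\<lambda>p. monomial G B b \<sigma> (fst p) \<otimes>\<^bsub>B\<^esub> monomial G B c \<tau> (snd p) \<otimes>\<^bsub>B\<^esub> \<beta> (fst p) (snd p)"
  have "(monomial G B b \<sigma> \<otimes>\<^bsub>twisted_groupoid_ring G B \<beta>\<^esub> monomial G B c \<tau>) \<rho> =
      (if composable G \<sigma> \<tau> \<and> \<sigma> \<cdot>\<^bsub>G\<^esub> \<tau> = \<rho> then b \<otimes>\<^bsub>B\<^esub> c \<otimes>\<^bsub>B\<^esub> \<beta> \<sigma> \<tau> else \<zero>\<^bsub>B\<^esub>)"
    if "\<rho> \<in> carrier G" for \<rho>
  proof -
    have "(monomial G B b \<sigma> \<otimes>\<^bsub>twisted_groupoid_ring G B \<beta>\<^esub> monomial G B c \<tau>) \<rho> = finsum B ?F (?P \<rho>)"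
      using that by (simp add: twisted_groupoid_ring_def)
    moreover have "?F (\<sigma>, \<tau>) = b \<otimes>\<^bsub>B\<^esub> c \<otimes>\<^bsub>B\<^esub> \<beta> \<sigma> \<tau>"
      using G by (simp add: monomial_def)
    moreover have "b \<otimes>\<^bsub>B\<^esub> c \<otimes>\<^bsub>B\<^esub> \<beta> \<sigma> \<tau> \<in> carrier B" if "composable G \<sigma> \<tau>"
      using B twist_closed[OF that] by simp
    moreover have "b \<otimes>\<^bsub>B\<^esub> c \<otimes>\<^bsub>B\<^esub> \<beta> \<sigma> \<tau> = \<zero>\<^bsub>B\<^esub>"
      if "composable G \<sigma> \<tau>" "b = \<zero>\<^bsub>B\<^esub> \<or> c = \<zero>\<^bsub>B\<^esub>"
      using that B twist_closed[OF that(1)] by auto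
    ultimately show ?thesis
      by (auto simp only: P finsum_empty finsum_insert finite.emptyI empty_iff Pi_I
            split_paired_all fst_conv snd_conv split: if_splits)
        (simp_all add: finsum_insert)
  qed
  then show ?thesis
    by (auto simp: fun_eq_iff monomial_def twisted_groupoid_ring_def)
qed

end

theory Submission
  imports Defs
begin

text \<open>
  In \<open>B \<rtimes>\<^sub>\<beta> \<G>\<close> the elements \<open>b u\<^sub>e\<close> form the copy of \<open>B\<close> at the object \<open>e\<close>, and \<open>1 u\<^sub>\<sigma>\<close> is
  object invertible because \<open>\<beta>\<close> takes values in central units. Conversely, an object
  invertible \<open>u\<^sub>\<sigma>\<close> makes \<open>R\<^sub>\<sigma> = R\<^sub>r\<^sub>(\<^sub>\<sigma>\<^sub>) u\<^sub>\<sigma>\<close> free of rank one, so that \<open>u\<^sub>\<sigma> u\<^sub>\<tau>\<close> is a unique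
  multiple of \<open>u\<^sub>\<sigma>\<^sub>\<tau>\<close>, whose coefficient defines \<open>\<beta>\<close>. Commutation of the \<open>u\<^sub>\<sigma>\<close> with the copies of
  \<open>B\<close> makes \<open>\<beta>\<close> central, associativity in \<open>R\<close> is the cocycle identity, and reading off the
  coefficients of the homogeneous components is the isomorphism.
\<close>

section \<open>Additive maps and finite sums\<close>

text \<open>Only additivity on the carriers is assumed, because the maps in question, such as
  \<open>\<lambda>b. mon b \<sigma>\<close> or the reading of a single coefficient, need not respect
  products.\<close>

lemma additive_map_zero:
  assumes "abelian_group R" "abelian_group S"
    and "h \<in> carrier R \<rightarrow> carrier S"
    and add: "\<And>x y. \<lbrakk>x \<in> carrier R; y \<in> carrier R\<rbrakk> \<Longrightarrow> h (x \<oplus>\<^bsub>R\<^esub> y) = h x \<oplus>\<^bsub>S\<^esub> h y"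
  shows "h \<zero>\<^bsub>R\<^esub> = \<zero>\<^bsub>S\<^esub>"
proof -
  interpret R: abelian_group R by fact
  interpret S: abelian_group S by fact
  have "h \<zero>\<^bsub>R\<^esub> \<in> carrier S" using assms by auto
  moreover have "h \<zero>\<^bsub>R\<^esub> \<oplus>\<^bsub>S\<^esub> h \<zero>\<^bsub>R\<^esub> = h \<zero>\<^bsub>R\<^esub>" using add[of "\<zero>\<^bsub>R\<^esub>" "\<zero>\<^bsub>R\<^esub>"] by simp
  ultimately show ?thesis by (simp add: S.add.r_cancel_one)
qed

lemma additive_map_finsum:
  assumes "abelian_group R" "abelian_group S"
    and h: "h \<in> carrier R \<rightarrow> carrier S"
    and add: "\<And>x y. \<lbrakk>x \<in> carrier R; y \<in> carrier R\<rbrakk> \<Longrightarrow> h (x \<oplus>\<^bsub>R\<^esub> y) = h x \<oplus>\<^bsub>S\<^esub> h y"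
    and "finite A" "f \<in> A \<rightarrow> carrier R"
  shows "h (finsum R f A) = finsum S (\<lambda>a. h (f a)) A"
proof -
  interpret R: abelian_group R by fact
  interpret S: abelian_group S by fact
  show ?thesis using assms(5,6)
  proof (induction A)
    case empty
    then show ?case using additive_map_zero[OF assms(1-4)] by simp
  next
    case (insert a A)
    then have "f \<in> A \<rightarrow> carrier R" "f a \<in> carrier R" by auto
    moreover from this have "finsum R f A \<in> carrier R" "(\<lambda>a. h (f a)) \<in> A \<rightarrow> carrier S"
      "h (f a) \<in> carrier S" using h by auto
    ultimately show ?case using insert add by simp
  qed
qed

text \<open>Induction on the left index set: a new index a contributes the row of pairs (a, c),
  which additivity in the second argument adds up. With F x y a fixed coefficient of the product of
  x and y, this expands a product over pairs of homogeneous parts.\<close>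

lemma biadditive_map_finsum:
  assumes "abelian_group R" "abelian_group S"
    and F: "\<And>x y. \<lbrakk>x \<in> carrier R; y \<in> carrier R\<rbrakk> \<Longrightarrow> F x y \<in> carrier S"
    and l: "\<And>x y z. \<lbrakk>x \<in> carrier R; y \<in> carrier R; z \<in> carrier R\<rbrakk>
      \<Longrightarrow> F (x \<oplus>\<^bsub>R\<^esub> y) z = F x z \<oplus>\<^bsub>S\<^esub> F y z"
    and r: "\<And>x y z. \<lbrakk>x \<in> carrier R; y \<in> carrier R; z \<in> carrier R\<rbrakk>
      \<Longrightarrow> F z (x \<oplus>\<^bsub>R\<^esub> y) = F z x \<oplus>\<^bsub>S\<^esub> F z y"
    and fin: "finite A" "finite C" and f: "f \<in> A \<rightarrow> carrier R" and g: "g \<in> C \<rightarrow> carrier R"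
  shows "F (finsum R f A) (finsum R g C) = finsum S (\<lambda>p. F (f (fst p)) (g (snd p))) (A \<times> C)"
proof -
  interpret R: abelian_group R by fact
  interpret S: abelian_group S by fact
  have gC: "finsum R g C \<in> carrier R" using g by simp
  show ?thesis using fin(1) f
  proof (induction A)
    case empty
    have "F \<zero>\<^bsub>R\<^esub> (finsum R g C) = \<zero>\<^bsub>S\<^esub>"
      using additive_map_zero[OF assms(1,2), of "\<lambda>x. F x (finsum R g C)"] F l gC by auto
    then show ?case by simp
  next
    case (insert a A)
    let ?T = "\<lambda>p. F (f (fst p)) (g (snd p))"
    from insert.prems have f': "f \<in> A \<rightarrow> carrier R" "f a \<in> carrier R" by auto
    have row: "finsum S ?T (Pair a ` C) = F (f a) (finsum R g C)"
    proof -
      have "finsum S ?T (Pair a ` C) = finsum S (\<lambda>c. ?T (a, c)) C"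
        using f' g F by (intro S.finsum_reindex) (auto simp: inj_on_def Pi_iff)
      also have "\<dots> = F (f a) (finsum R g C)"
        using additive_map_finsum[OF assms(1,2), of "F (f a)" C g] F r f' g fin by auto
      finally show ?thesis .
    qed
    have "insert a A \<times> C = Pair a ` C \<union> A \<times> C" by auto
    then have "finsum S ?T (insert a A \<times> C) = finsum S ?T (Pair a ` C) \<oplus>\<^bsub>S\<^esub> finsum S ?T (A \<times> C)"
      using insert.hyps fin f' g F
      by (simp only:) (intro S.finsum_Un_disjoint, auto simp: Pi_iff)
    with row insert.IH[OF f'(1)] insert.hyps f' gC l show ?case
      by simp
  qed
qed

section \<open>Groupoids\<close>

context groupoid
begin

lemma target_in_objects: "\<sigma> \<in> carrier G \<Longrightarrow> target G \<sigma> \<in> objects G"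
  and source_in_objects: "\<sigma> \<in> carrier G \<Longrightarrow> source G \<sigma> \<in> objects G"
  by (auto simp: objects_def source_closed target_closed source_source source_target)

lemma objects_closed: "e \<in> objects G \<Longrightarrow> e \<in> carrier G"
  and source_object: "e \<in> objects G \<Longrightarrow> source G e = e"
  by (auto simp: objects_def)

lemma target_object: "e \<in> objects G \<Longrightarrow> target G e = e"
  using target_source[of e] by (simp add: objects_def)

lemma comp_object: "e \<in> objects G \<Longrightarrow> e \<cdot> e = e"
  using comp_source[of e] by (simp add: objects_def)

lemma ginv_closed: "\<sigma> \<in> carrier G \<Longrightarrow> ginv G \<sigma> \<in> carrier G"
  and source_ginv: "\<sigma> \<in> carrier G \<Longrightarrow> source G (ginv G \<sigma>) = target G \<sigma>"
  and target_ginv: "\<sigma> \<in> carrier G \<Longrightarrow> target G (ginv G \<sigma>) = source G \<sigma>"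
  and comp_ginv: "\<sigma> \<in> carrier G \<Longrightarrow> \<sigma> \<cdot> ginv G \<sigma> = target G \<sigma>"
  and ginv_comp: "\<sigma> \<in> carrier G \<Longrightarrow> ginv G \<sigma> \<cdot> \<sigma> = source G \<sigma>"
  using inverse_of_ginv[of \<sigma>] by (auto simp: inverse_of_def composable_def)

lemma ginv_object:
  assumes "e \<in> objects G"
  shows "ginv G e = e"
proof (rule inverse_of_unique)
  show "inverse_of G e (ginv G e)" using assms by (simp add: inverse_of_ginv objects_closed)
  show "inverse_of G e e"
    using assms
    by (simp add: inverse_of_def composable_def objects_closed source_object target_object
        comp_object)
qed

end

section \<open>Homogeneous components\<close>

context graded_ring
begin

lemma component_subset: "\<sigma> \<in> carrier G \<Longrightarrow> Rg \<sigma> \<subseteq> carrier R"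
  by (rule additive_subgroup.a_subset[OF component])

lemma component_carrier: "\<lbrakk>\<sigma> \<in> carrier G; x \<in> Rg \<sigma>\<rbrakk> \<Longrightarrow> x \<in> carrier R"
  by (rule subsetD[OF component_subset])

lemma component_zero: "\<sigma> \<in> carrier G \<Longrightarrow> \<zero>\<^bsub>R\<^esub> \<in> Rg \<sigma>"
  by (rule additive_subgroup.zero_closed[OF component])

lemma component_add: "\<lbrakk>\<sigma> \<in> carrier G; x \<in> Rg \<sigma>; y \<in> Rg \<sigma>\<rbrakk> \<Longrightarrow> x \<oplus>\<^bsub>R\<^esub> y \<in> Rg \<sigma>"
  by (rule additive_subgroup.a_closed[OF component])

text \<open>The family of homogeneous components of x. For x in R the description is justified by
  \<open>direct_sum\<close>, where uniqueness presupposes families that are \<open>undefined\<close>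
  outside \<open>carrier G\<close>.\<close>

definition parts :: "'r \<Rightarrow> 'g \<Rightarrow> 'r" where
  "parts x = (THE f. f \<in> (\<Pi>\<^sub>E \<sigma>\<in>carrier G. Rg \<sigma>) \<and> finite (support R (carrier G) f) \<and>
        x = (\<Oplus>\<^bsub>R\<^esub>\<sigma>\<in>support R (carrier G) f. f \<sigma>))"

lemma parts:
  assumes "x \<in> carrier R"
  shows parts_PiE: "parts x \<in> (\<Pi>\<^sub>E \<sigma>\<in>carrier G. Rg \<sigma>)"
    and finite_support_parts: "finite (support R (carrier G) (parts x))"
    and sum_parts: "(\<Oplus>\<^bsub>R\<^esub>\<sigma>\<in>support R (carrier G) (parts x). parts x \<sigma>) = x"
  using theI'[OF direct_sum[OF assms]] unfolding parts_def by auto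

lemma parts_in: "\<lbrakk>x \<in> carrier R; \<sigma> \<in> carrier G\<rbrakk> \<Longrightarrow> parts x \<sigma> \<in> Rg \<sigma>"
  using parts_PiE by (auto simp: PiE_iff)

text \<open>Uniqueness of the decomposition. Summing over a finite A that contains the support
  changes nothing, since the extra terms vanish, and frees the applications from computing the exact
  support.\<close>

lemma parts_eqI:
  assumes f: "f \<in> (\<Pi>\<^sub>E \<sigma>\<in>carrier G. Rg \<sigma>)"
    and A: "finite A" "A \<subseteq> carrier G" "support R (carrier G) f \<subseteq> A"
    and x: "(\<Oplus>\<^bsub>R\<^esub>\<sigma>\<in>A. f \<sigma>) = x"
  shows "parts x = f"
proof -
  have fA: "f \<in> A \<rightarrow> carrier R" using f A component_carrier by (force simp: PiE_iff)
  have "(\<Oplus>\<^bsub>R\<^esub>\<sigma>\<in>support R (carrier G) f. f \<sigma>) = x"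
    unfolding x[symmetric]
    by (rule add.finprod_mono_neutral_cong_left) (use A fA in \<open>auto simp: support_def\<close>)
  moreover have "finite (support R (carrier G) f)" using A finite_subset by blast
  moreover have "x \<in> carrier R" using x fA by auto
  ultimately show ?thesis
    using f direct_sum[of x] parts_PiE[of x] finite_support_parts[of x] sum_parts[of x] by metis
qed

lemma sum_parts_superset:
  assumes "x \<in> carrier R" "finite A" "A \<subseteq> carrier G" "support R (carrier G) (parts x) \<subseteq> A"
  shows "(\<Oplus>\<^bsub>R\<^esub>\<sigma>\<in>A. parts x \<sigma>) = x"
proof -
  have "(\<Oplus>\<^bsub>R\<^esub>\<sigma>\<in>support R (carrier G) (parts x). parts x \<sigma>) = (\<Oplus>\<^bsub>R\<^esub>\<sigma>\<in>A. parts x \<sigma>)"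
    by (rule add.finprod_mono_neutral_cong_left)
      (use assms parts_in component_carrier in \<open>auto simp: support_def\<close>)
  then show ?thesis using sum_parts[OF assms(1)] by simp
qed

lemma parts_add:
  assumes "x \<in> carrier R" "y \<in> carrier R" "\<sigma> \<in> carrier G"
  shows "parts (x \<oplus>\<^bsub>R\<^esub> y) \<sigma> = parts x \<sigma> \<oplus>\<^bsub>R\<^esub> parts y \<sigma>"
proof -
  \<comment> \<open>Cancellation can make the support of the sum smaller than this union, so the
    union serves as a common index set.\<close>
  let ?A = "support R (carrier G) (parts x) \<union> support R (carrier G) (parts y)"
  have A: "finite ?A" "?A \<subseteq> carrier G"
    using assms finite_support_parts by (auto simp: support_def)
  have "parts (x \<oplus>\<^bsub>R\<^esub> y) = (\<lambda>\<sigma>\<in>carrier G. parts x \<sigma> \<oplus>\<^bsub>R\<^esub> parts y \<sigma>)"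
  proof (rule parts_eqI[of _ ?A])
    show "(\<lambda>\<sigma>\<in>carrier G. parts x \<sigma> \<oplus>\<^bsub>R\<^esub> parts y \<sigma>) \<in> (\<Pi>\<^sub>E \<sigma>\<in>carrier G. Rg \<sigma>)"
      using assms parts_in component_add by auto
    show "support R (carrier G) (\<lambda>\<sigma>\<in>carrier G. parts x \<sigma> \<oplus>\<^bsub>R\<^esub> parts y \<sigma>) \<subseteq> ?A"
      by (auto simp: support_def)
    have c: "parts x \<in> ?A \<rightarrow> carrier R" "parts y \<in> ?A \<rightarrow> carrier R"
      using assms parts_in component_carrier A(2) by (blast intro: Pi_I)+
    have "(\<Oplus>\<^bsub>R\<^esub>\<sigma>\<in>?A. (\<lambda>\<sigma>\<in>carrier G. parts x \<sigma> \<oplus>\<^bsub>R\<^esub> parts y \<sigma>) \<sigma>)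
        = (\<Oplus>\<^bsub>R\<^esub>\<sigma>\<in>?A. parts x \<sigma> \<oplus>\<^bsub>R\<^esub> parts y \<sigma>)"
      by (rule finsum_cong') (use A(2) c in \<open>auto simp: support_def Pi_iff\<close>)
    also have "\<dots> = (\<Oplus>\<^bsub>R\<^esub>\<sigma>\<in>?A. parts x \<sigma>) \<oplus>\<^bsub>R\<^esub> (\<Oplus>\<^bsub>R\<^esub>\<sigma>\<in>?A. parts y \<sigma>)"
      using c by (rule finsum_addf)
    also have "\<dots> = x \<oplus>\<^bsub>R\<^esub> y"
      using assms A sum_parts_superset[of x ?A] sum_parts_superset[of y ?A] by simp
    finally show "(\<Oplus>\<^bsub>R\<^esub>\<sigma>\<in>?A. (\<lambda>\<sigma>\<in>carrier G. parts x \<sigma> \<oplus>\<^bsub>R\<^esub> parts y \<sigma>) \<sigma>) = x \<oplus>\<^bsub>R\<^esub> y" .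
  qed (use A in auto)
  then show ?thesis using assms by simp
qed

lemma parts_homogeneous:
  assumes "\<sigma> \<in> carrier G" "x \<in> Rg \<sigma>" "\<tau> \<in> carrier G"
  shows "parts x \<tau> = (if \<tau> = \<sigma> then x else \<zero>\<^bsub>R\<^esub>)"
proof -
  have "x \<in> carrier R" using assms(1,2) by (rule component_carrier)
  \<comment> \<open>The index set \<open>{\<sigma>}\<close> also covers x = 0, where the support is
    empty.\<close>
  have "parts x = (\<lambda>\<tau>\<in>carrier G. if \<tau> = \<sigma> then x else \<zero>\<^bsub>R\<^esub>)"
  proof (rule parts_eqI[of _ "{\<sigma>}"])
    show "(\<lambda>\<tau>\<in>carrier G. if \<tau> = \<sigma> then x else \<zero>\<^bsub>R\<^esub>) \<in> (\<Pi>\<^sub>E \<sigma>\<in>carrier G. Rg \<sigma>)"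
      using assms component_zero by simp
    show "support R (carrier G) (\<lambda>\<tau>\<in>carrier G. if \<tau> = \<sigma> then x else \<zero>\<^bsub>R\<^esub>) \<subseteq> {\<sigma>}"
      by (auto simp: support_def)
    show "(\<Oplus>\<^bsub>R\<^esub>\<tau>\<in>{\<sigma>}. (\<lambda>\<tau>\<in>carrier G. if \<tau> = \<sigma> then x else \<zero>\<^bsub>R\<^esub>) \<tau>) = x"
      using assms \<open>x \<in> carrier R\<close> by simp
  qed (use assms in simp_all)
  then show ?thesis using assms by simp
qed

lemma parts_inject:
  assumes "x \<in> carrier R" "y \<in> carrier R" "\<And>\<sigma>. \<sigma> \<in> carrier G \<Longrightarrow> parts x \<sigma> = parts y \<sigma>"
  shows "x = y"
proof -
  have "parts x = parts y"
    using PiE_ext[OF parts_PiE[OF assms(1)] parts_PiE[OF assms(2)]] assms(3) by blast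
  then show ?thesis using sum_parts[OF assms(1)] sum_parts[OF assms(2)] by metis
qed

end

section \<open>Identities of the rings at the objects\<close>

context object_unital_ring
begin

abbreviation local_one where
  "local_one e \<equiv> unit_of R (Rg e)"

lemma local_one_in: "e \<in> objects G \<Longrightarrow> local_one e \<in> Rg e"
  using monoid.one_closed[OF ring.is_monoid, OF unital_component, of e] by (simp add: subring_on_def)

text \<open>A left identity w suffices: multiplied on the right by \<open>local_one e\<close> it
  gives \<open>local_one e\<close> by assumption and w by \<open>unit_right\<close>.\<close>

lemma local_one_eqI:
  assumes "e \<in> objects G" "w \<in> Rg e" "\<And>x. x \<in> Rg e \<Longrightarrow> w \<otimes>\<^bsub>R\<^esub> x = x"
  shows "local_one e = w"
  using assms(3)[OF local_one_in[OF assms(1)]] unit_right[of e w] assms(1,2)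
  by (simp add: objects_closed source_object)

text \<open>The identity is its own inverse, as \<open>ginv G e = e\<close>. Hence it may be chosen
  as the invertible element at an object.\<close>

lemma object_invertible_local_one:
  assumes "e \<in> objects G"
  shows "object_invertible G R Rg e (local_one e)"
proof -
  note e = objects_closed[OF assms] source_object[OF assms] target_object[OF assms]
    local_one_in[OF assms]
  have "local_one e \<otimes>\<^bsub>R\<^esub> local_one e = local_one e"
    using unit_left[OF e(1,4)] e by simp
  then show ?thesis
    using e ginv_object[OF assms] by (auto simp: object_invertible_def)
qed

end

section \<open>From invertible elements to a twist\<close>

text \<open>Conditions (i) and (ii) with all choices made: \<open>v \<sigma>\<close> is an inverse
  of \<open>u \<sigma>\<close>. The assumption \<open>u_object\<close> will normalize the twist, and
  the last one supplies the non-zero coefficient ring that a twist requires.\<close>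

locale object_unital_copies = object_unital_ring G R Rg + B: ring B
  for G :: "('g, 'm) category_struct_scheme" (structure)
    and R :: "('r, 'n) ring_scheme" (structure)
    and Rg :: "'g \<Rightarrow> 'r set"
    and B :: "('b, 'k) ring_scheme" +
  fixes copy :: "'g \<Rightarrow> 'b \<Rightarrow> 'r" and u v :: "'g \<Rightarrow> 'r"
  assumes copy_iso: "e \<in> objects G \<Longrightarrow> copy e \<in> ring_iso B (subring_on R (Rg e))"
    and u_in: "\<sigma> \<in> carrier G \<Longrightarrow> u \<sigma> \<in> Rg \<sigma>"
    and v_in: "\<sigma> \<in> carrier G \<Longrightarrow> v \<sigma> \<in> Rg (ginv G \<sigma>)"
    and u_v: "\<sigma> \<in> carrier G \<Longrightarrow> u \<sigma> \<otimes>\<^bsub>R\<^esub> v \<sigma> = local_one (target G \<sigma>)"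
    and v_u: "\<sigma> \<in> carrier G \<Longrightarrow> v \<sigma> \<otimes>\<^bsub>R\<^esub> u \<sigma> = local_one (source G \<sigma>)"
    and copy_commute: "\<lbrakk>\<sigma> \<in> carrier G; b \<in> carrier B\<rbrakk>
      \<Longrightarrow> copy (target G \<sigma>) b \<otimes>\<^bsub>R\<^esub> u \<sigma> = u \<sigma> \<otimes>\<^bsub>R\<^esub> copy (source G \<sigma>) b"
    and u_object: "e \<in> objects G \<Longrightarrow> u e = local_one e"
    and one_neq_zero: "\<one>\<^bsub>B\<^esub> \<noteq> \<zero>\<^bsub>B\<^esub>"
begin

section \<open>Each component is free of rank one over its copy of B\<close>

lemma copy_in: "\<lbrakk>e \<in> objects G; b \<in> carrier B\<rbrakk> \<Longrightarrow> copy e b \<in> Rg e"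
  and copy_mult: "\<lbrakk>e \<in> objects G; b \<in> carrier B; c \<in> carrier B\<rbrakk>
    \<Longrightarrow> copy e (b \<otimes>\<^bsub>B\<^esub> c) = copy e b \<otimes>\<^bsub>R\<^esub> copy e c"
  and copy_add: "\<lbrakk>e \<in> objects G; b \<in> carrier B; c \<in> carrier B\<rbrakk>
    \<Longrightarrow> copy e (b \<oplus>\<^bsub>B\<^esub> c) = copy e b \<oplus>\<^bsub>R\<^esub> copy e c"
  and copy_one: "e \<in> objects G \<Longrightarrow> copy e \<one>\<^bsub>B\<^esub> = local_one e"
  and copy_bij: "e \<in> objects G \<Longrightarrow> bij_betw (copy e) (carrier B) (Rg e)"
  using copy_iso[of e] ring_iso_memE[of "copy e" B "subring_on R (Rg e)"]
  by (auto simp: subring_on_def)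

definition mon :: "'b \<Rightarrow> 'g \<Rightarrow> 'r" where
  "mon b \<sigma> = copy (target G \<sigma>) b \<otimes>\<^bsub>R\<^esub> u \<sigma>"

lemma mult_in: "\<lbrakk>\<sigma> \<in> carrier G; \<tau> \<in> carrier G; source G \<sigma> = target G \<tau>; x \<in> Rg \<sigma>; y \<in> Rg \<tau>\<rbrakk>
    \<Longrightarrow> x \<otimes>\<^bsub>R\<^esub> y \<in> Rg (\<sigma> \<cdot>\<^bsub>G\<^esub> \<tau>)"
  using mult_composable by (simp add: composable_def)

lemma mon_in:
  assumes "\<sigma> \<in> carrier G" "b \<in> carrier B"
  shows "mon b \<sigma> \<in> Rg \<sigma>"
proof -
  have "mon b \<sigma> \<in> Rg (target G \<sigma> \<cdot>\<^bsub>G\<^esub> \<sigma>)"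
    unfolding mon_def using assms
    by (intro mult_in) (auto simp: target_closed source_target copy_in target_in_objects u_in)
  then show ?thesis using assms by (simp add: target_comp_self)
qed

lemma mon_carrier: "\<lbrakk>\<sigma> \<in> carrier G; b \<in> carrier B\<rbrakk> \<Longrightarrow> mon b \<sigma> \<in> carrier R"
  by (rule component_carrier[OF _ mon_in])

lemma copy_carrier: "\<lbrakk>e \<in> objects G; b \<in> carrier B\<rbrakk> \<Longrightarrow> copy e b \<in> carrier R"
  by (rule component_carrier[OF objects_closed copy_in])

lemma u_carrier: "\<sigma> \<in> carrier G \<Longrightarrow> u \<sigma> \<in> carrier R"
  by (rule component_carrier[OF _ u_in])

lemma v_carrier: "\<sigma> \<in> carrier G \<Longrightarrow> v \<sigma> \<in> carrier R"
  by (rule component_carrier[OF ginv_closed v_in])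

lemma mon_add: "\<lbrakk>\<sigma> \<in> carrier G; b \<in> carrier B; c \<in> carrier B\<rbrakk>
    \<Longrightarrow> mon (b \<oplus>\<^bsub>B\<^esub> c) \<sigma> = mon b \<sigma> \<oplus>\<^bsub>R\<^esub> mon c \<sigma>"
  by (simp add: mon_def copy_add target_in_objects l_distr copy_carrier u_carrier)

lemma copy_mon: "\<lbrakk>\<sigma> \<in> carrier G; b \<in> carrier B; c \<in> carrier B\<rbrakk>
    \<Longrightarrow> copy (target G \<sigma>) b \<otimes>\<^bsub>R\<^esub> mon c \<sigma> = mon (b \<otimes>\<^bsub>B\<^esub> c) \<sigma>"
  by (simp add: mon_def copy_mult target_in_objects m_assoc copy_carrier u_carrier)

text \<open>The commutation condition carries c from the source of \<sigma> across
  \<open>u \<sigma>\<close> to the target, where it multiplies b from the right.\<close>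

lemma mon_copy: "\<lbrakk>\<sigma> \<in> carrier G; b \<in> carrier B; c \<in> carrier B\<rbrakk>
    \<Longrightarrow> mon b \<sigma> \<otimes>\<^bsub>R\<^esub> copy (source G \<sigma>) c = mon (b \<otimes>\<^bsub>B\<^esub> c) \<sigma>"
  by (simp add: mon_def copy_mult target_in_objects source_in_objects m_assoc copy_carrier
      u_carrier copy_commute[symmetric])

lemma mon_one: "\<sigma> \<in> carrier G \<Longrightarrow> mon \<one>\<^bsub>B\<^esub> \<sigma> = u \<sigma>"
  by (simp add: mon_def copy_one target_in_objects unit_left u_in)

text \<open>Cancelling \<open>u \<sigma>\<close> against \<open>v \<sigma>\<close> leaves the copy
  of b at the target, which determines b. This yields uniqueness of coefficients.\<close>

lemma mon_v: "\<lbrakk>\<sigma> \<in> carrier G; b \<in> carrier B\<rbrakk> \<Longrightarrow> mon b \<sigma> \<otimes>\<^bsub>R\<^esub> v \<sigma> = copy (target G \<sigma>) b"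
  using unit_right[of "target G \<sigma>" "copy (target G \<sigma>) b"]
  by (simp add: mon_def m_assoc copy_carrier u_carrier v_carrier target_in_objects u_v
      target_closed source_target copy_in)

lemma mon_inject:
  assumes "\<sigma> \<in> carrier G" "b \<in> carrier B" "c \<in> carrier B" "mon b \<sigma> = mon c \<sigma>"
  shows "b = c"
proof -
  have "copy (target G \<sigma>) b = copy (target G \<sigma>) c"
    using assms mon_v[of \<sigma> b] mon_v[of \<sigma> c] by simp
  then show ?thesis
    using bij_betw_imp_inj_on[OF copy_bij[OF target_in_objects[OF assms(1)]]] assms(2,3)
    by (simp add: inj_on_eq_iff)
qed

text \<open>Write x as \<open>(x \<otimes> v \<sigma>) \<otimes> u \<sigma>\<close>. The first
  factor has degree \<open>\<sigma> \<cdot> ginv G \<sigma> = target G \<sigma>\<close>, so it is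
  the copy of some b.\<close>

lemma mon_surj:
  assumes "\<sigma> \<in> carrier G" "x \<in> Rg \<sigma>"
  shows "\<exists>b\<in>carrier B. x = mon b \<sigma>"
proof -
  have "x \<otimes>\<^bsub>R\<^esub> v \<sigma> \<in> Rg (\<sigma> \<cdot>\<^bsub>G\<^esub> ginv G \<sigma>)"
    using assms by (intro mult_in) (auto simp: ginv_closed target_ginv v_in)
  then have "x \<otimes>\<^bsub>R\<^esub> v \<sigma> \<in> Rg (target G \<sigma>)" using assms by (simp add: comp_ginv)
  then obtain b where b: "b \<in> carrier B" "copy (target G \<sigma>) b = x \<otimes>\<^bsub>R\<^esub> v \<sigma>"
    unfolding bij_betw_imp_surj_on[OF copy_bij[OF target_in_objects[OF assms(1)]], symmetric]
    by auto
  have "mon b \<sigma> = x"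
    unfolding mon_def b(2) using assms
    by (simp add: m_assoc component_carrier u_carrier v_carrier v_u unit_right)
  then show ?thesis by (rule bexI[OF sym b(1)])
qed

section \<open>Coefficients of homogeneous elements\<close>

definition coeff :: "'g \<Rightarrow> 'r \<Rightarrow> 'b" where
  "coeff \<sigma> x = (THE b. b \<in> carrier B \<and> x = mon b \<sigma>)"

lemma coeff_mon: "\<lbrakk>\<sigma> \<in> carrier G; b \<in> carrier B\<rbrakk> \<Longrightarrow> coeff \<sigma> (mon b \<sigma>) = b"
  unfolding coeff_def by (rule the_equality) (auto dest: mon_inject)

lemma
  assumes "\<sigma> \<in> carrier G" "x \<in> Rg \<sigma>"
  shows coeff_closed: "coeff \<sigma> x \<in> carrier B" and mon_coeff: "mon (coeff \<sigma> x) \<sigma> = x"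
proof -
  obtain b where "b \<in> carrier B" "x = mon b \<sigma>" using mon_surj[OF assms] ..
  then show "coeff \<sigma> x \<in> carrier B" "mon (coeff \<sigma> x) \<sigma> = x"
    using coeff_mon[OF assms(1), of b] by simp_all
qed

lemma coeff_add:
  assumes "\<sigma> \<in> carrier G" "x \<in> Rg \<sigma>" "y \<in> Rg \<sigma>"
  shows "coeff \<sigma> (x \<oplus>\<^bsub>R\<^esub> y) = coeff \<sigma> x \<oplus>\<^bsub>B\<^esub> coeff \<sigma> y"
proof -
  have c: "coeff \<sigma> x \<in> carrier B" "coeff \<sigma> y \<in> carrier B" using assms coeff_closed by simp_all
  have "x \<oplus>\<^bsub>R\<^esub> y = mon (coeff \<sigma> x \<oplus>\<^bsub>B\<^esub> coeff \<sigma> y) \<sigma>"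
    using mon_add[OF assms(1) c] assms by (simp add: mon_coeff)
  then show ?thesis using coeff_mon[OF assms(1)] c by simp
qed

lemma mon_zero:
  assumes "\<sigma> \<in> carrier G"
  shows "mon \<zero>\<^bsub>B\<^esub> \<sigma> = \<zero>\<^bsub>R\<^esub>"
  by (rule additive_map_zero[where R = B])
    (simp_all add: assms mon_carrier mon_add B.is_abelian_group abelian_group_axioms)

text \<open>Ensures that the coefficients of an element of R have the same support as its
  homogeneous parts, so that finiteness carries over.\<close>

lemma coeff_zero_iff:
  assumes "\<sigma> \<in> carrier G" "x \<in> Rg \<sigma>"
  shows "coeff \<sigma> x = \<zero>\<^bsub>B\<^esub> \<longleftrightarrow> x = \<zero>\<^bsub>R\<^esub>"
proof
  assume "coeff \<sigma> x = \<zero>\<^bsub>B\<^esub>"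
  then show "x = \<zero>\<^bsub>R\<^esub>" using mon_coeff[OF assms] mon_zero[OF assms(1)] by simp
next
  assume "x = \<zero>\<^bsub>R\<^esub>"
  then show "coeff \<sigma> x = \<zero>\<^bsub>B\<^esub>"
    using coeff_mon[OF assms(1) B.zero_closed] mon_zero[OF assms(1)] by simp
qed

section \<open>The twist: central units, cocycle identity and normalization\<close>

definition twist :: "'g \<Rightarrow> 'g \<Rightarrow> 'b" where
  "twist \<sigma> \<tau> = coeff (\<sigma> \<cdot>\<^bsub>G\<^esub> \<tau>) (u \<sigma> \<otimes>\<^bsub>R\<^esub> u \<tau>)"

lemma twist_carrier: "composable G \<sigma> \<tau> \<Longrightarrow> twist \<sigma> \<tau> \<in> carrier B"
  and u_mult: "composable G \<sigma> \<tau> \<Longrightarrow> u \<sigma> \<otimes>\<^bsub>R\<^esub> u \<tau> = mon (twist \<sigma> \<tau>) (\<sigma> \<cdot>\<^bsub>G\<^esub> \<tau>)"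
  unfolding twist_def
  by (auto intro!: coeff_closed mon_coeff[symmetric] mult_in simp: composable_def comp_closed u_in)

text \<open>The copy of c sits at the target of \<tau>, which is the source of \<sigma>, so it can
  be moved left across \<open>u \<sigma>\<close>. What remains on the right is
  \<open>u \<sigma> \<otimes> u \<tau>\<close>, which the twist rewrites as a multiple of
  \<open>u (\<sigma> \<cdot> \<tau>)\<close>.\<close>

lemma mon_mult:
  assumes st: "composable G \<sigma> \<tau>" and b: "b \<in> carrier B" and c: "c \<in> carrier B"
  shows "mon b \<sigma> \<otimes>\<^bsub>R\<^esub> mon c \<tau> = mon (b \<otimes>\<^bsub>B\<^esub> c \<otimes>\<^bsub>B\<^esub> twist \<sigma> \<tau>) (\<sigma> \<cdot>\<^bsub>G\<^esub> \<tau>)"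
proof -
  from st have s: "\<sigma> \<in> carrier G" "\<tau> \<in> carrier G" "source G \<sigma> = target G \<tau>"
    by (auto simp: composable_def)
  have "mon b \<sigma> \<otimes>\<^bsub>R\<^esub> mon c \<tau> = (mon b \<sigma> \<otimes>\<^bsub>R\<^esub> copy (source G \<sigma>) c) \<otimes>\<^bsub>R\<^esub> u \<tau>"
    using s b c
    by (simp add: mon_def[of c] m_assoc mon_carrier copy_carrier u_carrier target_in_objects)
  also have "\<dots> = copy (target G \<sigma>) (b \<otimes>\<^bsub>B\<^esub> c) \<otimes>\<^bsub>R\<^esub> (u \<sigma> \<otimes>\<^bsub>R\<^esub> u \<tau>)"
    unfolding mon_copy[OF s(1) b c] unfolding mon_def using s b c
    by (simp add: m_assoc copy_carrier u_carrier target_in_objects)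
  also have "\<dots> = mon (b \<otimes>\<^bsub>B\<^esub> c \<otimes>\<^bsub>B\<^esub> twist \<sigma> \<tau>) (\<sigma> \<cdot>\<^bsub>G\<^esub> \<tau>)"
    using copy_mon[of "\<sigma> \<cdot>\<^bsub>G\<^esub> \<tau>" "b \<otimes>\<^bsub>B\<^esub> c" "twist \<sigma> \<tau>"] s b c st
    by (simp add: u_mult twist_carrier comp_closed target_comp)
  finally show ?thesis .
qed

lemma coeff_mult:
  assumes "composable G \<sigma> \<tau>" "x \<in> Rg \<sigma>" "y \<in> Rg \<tau>"
  shows "coeff (\<sigma> \<cdot>\<^bsub>G\<^esub> \<tau>) (x \<otimes>\<^bsub>R\<^esub> y) = coeff \<sigma> x \<otimes>\<^bsub>B\<^esub> coeff \<tau> y \<otimes>\<^bsub>B\<^esub> twist \<sigma> \<tau>"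
proof -
  have s: "\<sigma> \<in> carrier G" "\<tau> \<in> carrier G" "\<sigma> \<cdot>\<^bsub>G\<^esub> \<tau> \<in> carrier G"
    using assms(1) comp_closed by (auto simp: composable_def)
  have "x \<otimes>\<^bsub>R\<^esub> y = mon (coeff \<sigma> x \<otimes>\<^bsub>B\<^esub> coeff \<tau> y \<otimes>\<^bsub>B\<^esub> twist \<sigma> \<tau>) (\<sigma> \<cdot>\<^bsub>G\<^esub> \<tau>)"
    using mon_mult[OF assms(1), of "coeff \<sigma> x" "coeff \<tau> y"] assms s
    by (simp add: coeff_closed mon_coeff)
  then show ?thesis
    using assms s by (simp add: coeff_mon coeff_closed twist_carrier)
qed

text \<open>Both sides are the coefficient of \<open>u\<^sub>\<sigma> u\<^sub>\<tau> b\<close>, with \<open>b\<close> moved past the \<open>u\<close>'s before or after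
  they are multiplied.\<close>

lemma twist_central:
  assumes st: "composable G \<sigma> \<tau>" and b: "b \<in> carrier B"
  shows "twist \<sigma> \<tau> \<otimes>\<^bsub>B\<^esub> b = b \<otimes>\<^bsub>B\<^esub> twist \<sigma> \<tau>"
proof -
  from st have s: "\<sigma> \<in> carrier G" "\<tau> \<in> carrier G" "source G \<sigma> = target G \<tau>"
    by (auto simp: composable_def)
  have "mon (twist \<sigma> \<tau> \<otimes>\<^bsub>B\<^esub> b) (\<sigma> \<cdot>\<^bsub>G\<^esub> \<tau>) = (u \<sigma> \<otimes>\<^bsub>R\<^esub> u \<tau>) \<otimes>\<^bsub>R\<^esub> copy (source G \<tau>) b"
    using mon_copy[of "\<sigma> \<cdot>\<^bsub>G\<^esub> \<tau>" "twist \<sigma> \<tau>" b] s b st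
    by (simp add: u_mult twist_carrier comp_closed source_comp)
  also have "\<dots> = u \<sigma> \<otimes>\<^bsub>R\<^esub> mon b \<tau>"
    using s b by (simp add: mon_def m_assoc u_carrier copy_carrier source_in_objects copy_commute)
  also have "\<dots> = mon (b \<otimes>\<^bsub>B\<^esub> twist \<sigma> \<tau>) (\<sigma> \<cdot>\<^bsub>G\<^esub> \<tau>)"
    using mon_mult[OF st B.one_closed b] s b by (simp add: mon_one)
  finally show ?thesis
    by (rule mon_inject[rotated 3]) (simp_all add: s b st comp_closed twist_carrier)
qed

text \<open>The inverse of the twist is the coefficient of \<open>u\<^sub>\<sigma>\<^sub>\<tau> u\<^sub>\<tau>\<^sup>-\<^sup>1\<close> at \<open>u\<^sub>\<sigma>\<close>.\<close>

lemma twist_left_inverse: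
  assumes st: "composable G \<sigma> \<tau>"
  shows "\<exists>c\<in>carrier B. c \<otimes>\<^bsub>B\<^esub> twist \<sigma> \<tau> = \<one>\<^bsub>B\<^esub>"
proof -
  from st have s: "\<sigma> \<in> carrier G" "\<tau> \<in> carrier G" "source G \<sigma> = target G \<tau>"
    by (auto simp: composable_def)
  let ?\<rho> = "\<sigma> \<cdot>\<^bsub>G\<^esub> \<tau>"
  have r: "?\<rho> \<in> carrier G" "source G ?\<rho> = source G \<tau>" using s comp_closed source_comp by auto
  have "?\<rho> \<cdot>\<^bsub>G\<^esub> ginv G \<tau> = \<sigma> \<cdot>\<^bsub>G\<^esub> source G \<sigma>"
    using s by (simp add: comp_assoc ginv_closed target_ginv comp_ginv)
  then have "?\<rho> \<cdot>\<^bsub>G\<^esub> ginv G \<tau> = \<sigma>" using comp_source[OF s(1)] by simp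
  moreover have "u ?\<rho> \<otimes>\<^bsub>R\<^esub> v \<tau> \<in> Rg (?\<rho> \<cdot>\<^bsub>G\<^esub> ginv G \<tau>)"
    using s r by (intro mult_in) (auto simp: ginv_closed target_ginv u_in v_in)
  ultimately obtain c where c: "c \<in> carrier B" "u ?\<rho> \<otimes>\<^bsub>R\<^esub> v \<tau> = mon c \<sigma>"
    using mon_surj s by metis
  have "mon (c \<otimes>\<^bsub>B\<^esub> twist \<sigma> \<tau>) ?\<rho> = (u ?\<rho> \<otimes>\<^bsub>R\<^esub> v \<tau>) \<otimes>\<^bsub>R\<^esub> u \<tau>"
    using mon_mult[OF st c(1) B.one_closed] c s by (simp add: mon_one)
  also have "\<dots> = u ?\<rho> \<otimes>\<^bsub>R\<^esub> local_one (source G ?\<rho>)"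
    using s r by (simp add: m_assoc u_carrier v_carrier v_u)
  also have "\<dots> = mon \<one>\<^bsub>B\<^esub> ?\<rho>"
    unfolding unit_right[OF r(1) u_in[OF r(1)]] mon_one[OF r(1)] ..
  finally have "c \<otimes>\<^bsub>B\<^esub> twist \<sigma> \<tau> = \<one>\<^bsub>B\<^esub>"
    by (rule mon_inject[rotated 3]) (simp_all add: r c st twist_carrier)
  with c show ?thesis by blast
qed

text \<open>By centrality of the twist t its left inverse c is two-sided. Since units are taken
  inside the center, c must be central too: c b = c (b t) c = (c t) (b c) = b c.\<close>

lemma twist_is_unit:
  assumes st: "composable G \<sigma> \<tau>"
  shows "twist \<sigma> \<tau> \<in> Units (B\<lparr>carrier := ring_center B\<rparr>)"
proof -
  let ?t = "twist \<sigma> \<tau>"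
  obtain c where c: "c \<in> carrier B" "c \<otimes>\<^bsub>B\<^esub> ?t = \<one>\<^bsub>B\<^esub>" using twist_left_inverse[OF st] by blast
  have t: "?t \<in> carrier B" using twist_carrier[OF st] .
  have ct: "?t \<otimes>\<^bsub>B\<^esub> c = \<one>\<^bsub>B\<^esub>" using twist_central[OF st c(1)] c(2) by simp
  have "c \<otimes>\<^bsub>B\<^esub> b = b \<otimes>\<^bsub>B\<^esub> c" if b: "b \<in> carrier B" for b
  proof -
    have "c \<otimes>\<^bsub>B\<^esub> b = c \<otimes>\<^bsub>B\<^esub> (b \<otimes>\<^bsub>B\<^esub> ?t) \<otimes>\<^bsub>B\<^esub> c"
      using b c t ct by (simp add: B.m_assoc)
    also have "\<dots> = (c \<otimes>\<^bsub>B\<^esub> ?t) \<otimes>\<^bsub>B\<^esub> (b \<otimes>\<^bsub>B\<^esub> c)"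
      using b c(1) t by (simp add: twist_central[OF st b, symmetric] B.m_assoc)
    also have "\<dots> = b \<otimes>\<^bsub>B\<^esub> c" using b c by simp
    finally show ?thesis .
  qed
  then have "c \<in> ring_center B" "?t \<in> ring_center B"
    unfolding ring_center_def using c(1) t twist_central[OF st] by blast+
  then show ?thesis using c ct by (auto simp: Units_def)
qed

text \<open>Coefficients are compared in the two bracketings of
  \<open>u \<sigma> \<otimes> u \<tau> \<otimes> u \<rho>\<close>. On the right,
  \<open>twist \<tau> \<rho>\<close> is the coefficient of the second factor and has to pass
  \<open>u \<sigma>\<close>, which puts it in front of
  \<open>twist \<sigma> (\<tau> \<cdot> \<rho>)\<close>.\<close>

lemma twist_cocycle_eq:
  assumes st: "composable G \<sigma> \<tau>" and tr: "composable G \<tau> \<rho>"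
  shows "twist \<sigma> \<tau> \<otimes>\<^bsub>B\<^esub> twist (\<sigma> \<cdot>\<^bsub>G\<^esub> \<tau>) \<rho> = twist \<tau> \<rho> \<otimes>\<^bsub>B\<^esub> twist \<sigma> (\<tau> \<cdot>\<^bsub>G\<^esub> \<rho>)"
proof -
  have s: "\<sigma> \<in> carrier G" "\<tau> \<in> carrier G" "\<rho> \<in> carrier G"
    "source G \<sigma> = target G \<tau>" "source G \<tau> = target G \<rho>"
    using st tr by (auto simp: composable_def)
  have l: "composable G (\<sigma> \<cdot>\<^bsub>G\<^esub> \<tau>) \<rho>" and r: "composable G \<sigma> (\<tau> \<cdot>\<^bsub>G\<^esub> \<rho>)"
    using s by (auto simp: composable_def comp_closed source_comp target_comp)
  have "mon (twist \<sigma> \<tau> \<otimes>\<^bsub>B\<^esub> twist (\<sigma> \<cdot>\<^bsub>G\<^esub> \<tau>) \<rho>) (\<sigma> \<cdot>\<^bsub>G\<^esub> \<tau> \<cdot>\<^bsub>G\<^esub> \<rho>) = (u \<sigma> \<otimes>\<^bsub>R\<^esub> u \<tau>) \<otimes>\<^bsub>R\<^esub> u \<rho>"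
    using mon_mult[OF l twist_carrier[OF st] B.one_closed] s st
    by (simp add: u_mult mon_one twist_carrier)
  also have "\<dots> = u \<sigma> \<otimes>\<^bsub>R\<^esub> (u \<tau> \<otimes>\<^bsub>R\<^esub> u \<rho>)" using s by (simp add: m_assoc u_carrier)
  also have "\<dots> = mon (twist \<tau> \<rho> \<otimes>\<^bsub>B\<^esub> twist \<sigma> (\<tau> \<cdot>\<^bsub>G\<^esub> \<rho>)) (\<sigma> \<cdot>\<^bsub>G\<^esub> \<tau> \<cdot>\<^bsub>G\<^esub> \<rho>)"
    using mon_mult[OF r B.one_closed twist_carrier[OF tr]] s tr
    by (simp add: u_mult mon_one twist_carrier comp_assoc)
  finally show ?thesis
    by (rule mon_inject[rotated 3])
      (simp_all add: l r s st tr twist_carrier comp_closed source_comp target_comp)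
qed

lemma object_twist_twist: "object_twist G B twist"
proof
  fix \<sigma> assume s: "\<sigma> \<in> carrier G"
  \<comment> \<open>Normalization: u at an object is the identity there, so both products are
    \<open>u \<sigma>\<close>, whose coefficient is 1.\<close>
  have "u \<sigma> \<otimes>\<^bsub>R\<^esub> u (source G \<sigma>) = u \<sigma>" "u (target G \<sigma>) \<otimes>\<^bsub>R\<^esub> u \<sigma> = u \<sigma>"
    using s by (simp_all add: u_object source_in_objects target_in_objects unit_left unit_right u_in)
  then show "twist \<sigma> (source G \<sigma>) = \<one>\<^bsub>B\<^esub>" "twist (target G \<sigma>) \<sigma> = \<one>\<^bsub>B\<^esub>"
    using s coeff_mon[of \<sigma> "\<one>\<^bsub>B\<^esub>"]
    by (simp_all add: twist_def comp_source target_comp_self mon_one)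
qed (use one_neq_zero twist_is_unit twist_cocycle_eq in auto)

section \<open>The coefficient map is a graded isomorphism\<close>

definition coefficient_map :: "'r \<Rightarrow> 'g \<Rightarrow> 'b" where
  "coefficient_map x = (\<lambda>\<sigma>\<in>carrier G. coeff \<sigma> (parts x \<sigma>))"

lemma coefficient_map_closed:
  "\<lbrakk>x \<in> carrier R; \<sigma> \<in> carrier G\<rbrakk> \<Longrightarrow> coefficient_map x \<sigma> \<in> carrier B"
  by (simp add: coefficient_map_def coeff_closed parts_in)

lemma coefficient_map_add:
  assumes "x \<in> carrier R" "y \<in> carrier R" "\<sigma> \<in> carrier G"
  shows "coefficient_map (x \<oplus>\<^bsub>R\<^esub> y) \<sigma> = coefficient_map x \<sigma> \<oplus>\<^bsub>B\<^esub> coefficient_map y \<sigma>"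
  using assms by (simp add: coefficient_map_def parts_add coeff_add parts_in)

lemma coefficient_map_homogeneous:
  assumes "\<sigma> \<in> carrier G" "x \<in> Rg \<sigma>" "\<rho> \<in> carrier G"
  shows "coefficient_map x \<rho> = (if \<rho> = \<sigma> then coeff \<sigma> x else \<zero>\<^bsub>B\<^esub>)"
  using assms coeff_zero_iff[of \<rho> "\<zero>\<^bsub>R\<^esub>"]
  by (simp add: coefficient_map_def parts_homogeneous component_zero)

lemma coefficient_map_zero: "\<sigma> \<in> carrier G \<Longrightarrow> coefficient_map \<zero>\<^bsub>R\<^esub> \<sigma> = \<zero>\<^bsub>B\<^esub>"
  using coefficient_map_homogeneous[of \<sigma> "\<zero>\<^bsub>R\<^esub>" \<sigma>] by (simp add: component_zero coeff_zero_iff)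

lemma support_coefficient_map:
  "x \<in> carrier R \<Longrightarrow> support B (carrier G) (coefficient_map x) = support R (carrier G) (parts x)"
  by (auto simp: support_def coefficient_map_def coeff_zero_iff parts_in)

lemma coefficient_map_finsum:
  assumes "finite A" "f \<in> A \<rightarrow> carrier R" "\<sigma> \<in> carrier G"
  shows "coefficient_map (finsum R f A) \<sigma> = (\<Oplus>\<^bsub>B\<^esub>a\<in>A. coefficient_map (f a) \<sigma>)"
  by (rule additive_map_finsum[where h = "\<lambda>x. coefficient_map x \<sigma>"])
    (use assms coefficient_map_closed coefficient_map_add B.is_abelian_group abelian_group_axioms
      in auto)

text \<open>Both factors are expanded into homogeneous parts. At a fixed \<rho>, a pair of parts
  contributes only if its degrees compose to \<rho>, and then \<open>coeff_mult\<close> gives the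
  corresponding term of the twisted product.\<close>

lemma coefficient_map_mult:
  assumes x: "x \<in> carrier R" and y: "y \<in> carrier R"
  shows "coefficient_map (x \<otimes>\<^bsub>R\<^esub> y)
    = coefficient_map x \<otimes>\<^bsub>twisted_groupoid_ring G B twist\<^esub> coefficient_map y"
proof
  fix \<rho>
  let ?X = "support R (carrier G) (parts x)" and ?Y = "support R (carrier G) (parts y)"
  let ?P = "{(\<sigma>, \<tau>) \<in> ?X \<times> ?Y. composable G \<sigma> \<tau> \<and> \<sigma> \<cdot>\<^bsub>G\<^esub> \<tau> = \<rho>}"
  let ?f = "\<lambda>p. coefficient_map x (fst p) \<otimes>\<^bsub>B\<^esub> coefficient_map y (snd p) \<otimes>\<^bsub>B\<^esub> twist (fst p) (snd p)"
  let ?g = "\<lambda>p. coefficient_map (parts x (fst p) \<otimes>\<^bsub>R\<^esub> parts y (snd p)) \<rho>"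
  show "coefficient_map (x \<otimes>\<^bsub>R\<^esub> y) \<rho>
    = (coefficient_map x \<otimes>\<^bsub>twisted_groupoid_ring G B twist\<^esub> coefficient_map y) \<rho>"
  proof (cases "\<rho> \<in> carrier G")
    \<comment> \<open>Outside \<open>carrier G\<close> both sides are
      \<open>undefined\<close>.\<close>
    case False
    then show ?thesis by (simp add: coefficient_map_def twisted_groupoid_ring_def)
  next
    case \<rho>: True
    have X: "finite ?X" "parts x \<in> ?X \<rightarrow> carrier R" and Y: "finite ?Y" "parts y \<in> ?Y \<rightarrow> carrier R"
      using x y finite_support_parts parts_in component_carrier
      by (auto simp: support_def intro!: Pi_I)
    have prod: "coefficient_map (parts x \<sigma> \<otimes>\<^bsub>R\<^esub> parts y \<tau>) \<rho> =
        (if composable G \<sigma> \<tau> \<and> \<sigma> \<cdot>\<^bsub>G\<^esub> \<tau> = \<rho>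
         then coefficient_map x \<sigma> \<otimes>\<^bsub>B\<^esub> coefficient_map y \<tau> \<otimes>\<^bsub>B\<^esub> twist \<sigma> \<tau> else \<zero>\<^bsub>B\<^esub>)"
      if s: "\<sigma> \<in> carrier G" "\<tau> \<in> carrier G" for \<sigma> \<tau>
    proof (cases "composable G \<sigma> \<tau>")
      case True
      then have "\<sigma> \<cdot>\<^bsub>G\<^esub> \<tau> \<in> carrier G" by (simp add: composable_def comp_closed)
      then show ?thesis
        using True s x y \<rho> coefficient_map_homogeneous[of "\<sigma> \<cdot>\<^bsub>G\<^esub> \<tau>" "parts x \<sigma> \<otimes>\<^bsub>R\<^esub> parts y \<tau>" \<rho>]
        by (auto simp: mult_composable parts_in coeff_mult coefficient_map_def)
    next
      case False
      have "parts x \<sigma> \<otimes>\<^bsub>R\<^esub> parts y \<tau> = \<zero>\<^bsub>R\<^esub>"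
        by (rule mult_not_composable[OF s False parts_in[OF x s(1)] parts_in[OF y s(2)]])
      then show ?thesis using False \<rho> by (simp add: coefficient_map_zero)
    qed
    have "coefficient_map (x \<otimes>\<^bsub>R\<^esub> y) \<rho> =
        coefficient_map (finsum R (parts x) ?X \<otimes>\<^bsub>R\<^esub> finsum R (parts y) ?Y) \<rho>"
      using x y by (simp add: sum_parts)
    also have "\<dots> = finsum B ?g (?X \<times> ?Y)"
      by (rule biadditive_map_finsum[where F = "\<lambda>x y. coefficient_map (x \<otimes>\<^bsub>R\<^esub> y) \<rho>"])
        (use X Y \<rho> in \<open>auto simp: abelian_group_axioms B.is_abelian_group coefficient_map_closed
            m_closed l_distr r_distr coefficient_map_add\<close>)
    \<comment> \<open>Pairs outside \<open>?P\<close> contribute zero, so the sum shrinks to the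
      index set of the twisted product.\<close>
    also have "\<dots> = finsum B ?f ?P"
    proof (rule B.add.finprod_mono_neutral_cong_left[symmetric])
      fix p
      show "?g p = \<zero>\<^bsub>B\<^esub>" if "p \<in> ?X \<times> ?Y - ?P"
      proof -
        from that have "fst p \<in> carrier G" "snd p \<in> carrier G"
          and "\<not> (composable G (fst p) (snd p) \<and> fst p \<cdot>\<^bsub>G\<^esub> snd p = \<rho>)"
          by (auto simp: support_def)
        then show ?thesis by (simp only: prod if_False)
      qed
      show "?f p = ?g p" if "p \<in> ?P"
      proof -
        from that have "fst p \<in> carrier G" "snd p \<in> carrier G"
          and "composable G (fst p) (snd p) \<and> fst p \<cdot>\<^bsub>G\<^esub> snd p = \<rho>"
          by (auto simp: support_def)
        then show ?thesis by (simp only: prod simp_thms if_True)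
      qed
    next
      show "?g \<in> ?X \<times> ?Y \<rightarrow> carrier B"
        using X(2) Y(2) \<rho> by (intro Pi_I coefficient_map_closed m_closed) (auto simp: Pi_iff)
    qed (use X(1) Y(1) in auto)
    finally show ?thesis
      using \<rho> x y by (simp add: twisted_groupoid_ring_def support_coefficient_map)
  qed
qed

lemma coefficient_map_carrier:
  "x \<in> carrier R \<Longrightarrow> coefficient_map x \<in> carrier (twisted_groupoid_ring G B twist)"
  using coefficient_map_closed[of x] finite_support_parts[of x] support_coefficient_map[of x]
  by (simp add: twisted_groupoid_ring_def PiE_iff) (simp add: coefficient_map_def)

lemma inj_on_coefficient_map: "inj_on coefficient_map (carrier R)"
proof (rule inj_onI)
  fix x y assume xy: "x \<in> carrier R" "y \<in> carrier R" "coefficient_map x = coefficient_map y"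
  show "x = y"
  proof (rule parts_inject[OF xy(1,2)])
    fix \<sigma> assume s: "\<sigma> \<in> carrier G"
    then have "coeff \<sigma> (parts x \<sigma>) = coeff \<sigma> (parts y \<sigma>)"
      using fun_cong[OF xy(3), of \<sigma>] by (simp add: coefficient_map_def)
    then have "mon (coeff \<sigma> (parts x \<sigma>)) \<sigma> = mon (coeff \<sigma> (parts y \<sigma>)) \<sigma>" by (rule arg_cong)
    then show "parts x \<sigma> = parts y \<sigma>"
      by (simp only: mon_coeff[OF s parts_in[OF xy(1) s]] mon_coeff[OF s parts_in[OF xy(2) s]])
  qed
qed

lemma coefficient_map_surj:
  assumes "f \<in> carrier (twisted_groupoid_ring G B twist)"
  shows "\<exists>x\<in>carrier R. coefficient_map x = f"
proof -
  let ?A = "support B (carrier G) f"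
  \<comment> \<open>The preimage is the formal sum f evaluated in R, with each formal generator
    replaced by the chosen \<open>u \<sigma>\<close>.\<close>
  let ?x = "\<Oplus>\<^bsub>R\<^esub>\<sigma>\<in>?A. mon (f \<sigma>) \<sigma>"
  from assms have f: "f \<in> carrier G \<rightarrow>\<^sub>E carrier B" and A: "finite ?A"
    by (auto simp: twisted_groupoid_ring_def)
  have fB: "f \<sigma> \<in> carrier B" if "\<sigma> \<in> carrier G" for \<sigma> using f that by auto
  have m: "(\<lambda>\<sigma>. mon (f \<sigma>) \<sigma>) \<in> ?A \<rightarrow> carrier R"
    using fB mon_carrier by (auto simp: support_def)
  have "coefficient_map ?x \<rho> = f \<rho>" if \<rho>: "\<rho> \<in> carrier G" for \<rho>
  proof -
    have "coefficient_map ?x \<rho> = (\<Oplus>\<^bsub>B\<^esub>\<sigma>\<in>?A. coefficient_map (mon (f \<sigma>) \<sigma>) \<rho>)"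
      using coefficient_map_finsum[OF A m \<rho>] .
    \<comment> \<open>Only the term of degree \<rho> survives. The intersection is empty precisely
      when \<open>f \<rho>\<close> is zero.\<close>
    also have "\<dots> = (\<Oplus>\<^bsub>B\<^esub>\<sigma>\<in>?A \<inter> {\<rho>}. f \<sigma>)"
      by (rule B.add.finprod_mono_neutral_cong_right)
        (use A \<rho> fB in \<open>auto simp: support_def coefficient_map_homogeneous[OF _ mon_in] coeff_mon\<close>)
    also have "\<dots> = f \<rho>"
      using \<rho> fB by (cases "f \<rho> = \<zero>\<^bsub>B\<^esub>") (auto simp: support_def B.finsum_insert)
    finally show ?thesis .
  qed
  then have "coefficient_map ?x = f"
    using f by (auto simp: fun_eq_iff coefficient_map_def PiE_iff extensional_def restrict_def)
  then show ?thesis using m by (intro bexI[of _ ?x]) auto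
qed

text \<open>A homogeneous x goes to the monomial with coefficient \<open>coeff \<sigma> x\<close>,
  and these coefficients exhaust B.\<close>

lemma image_component:
  assumes s: "\<sigma> \<in> carrier G"
  shows "coefficient_map ` Rg \<sigma> = twisted_component G B \<sigma>"
proof -
  interpret T: object_twist G B twist by (rule object_twist_twist)
  have "coefficient_map x = monomial G B (coeff \<sigma> x) \<sigma>" if "x \<in> Rg \<sigma>" for x
    using coefficient_map_homogeneous[OF s that]
    by (auto simp: fun_eq_iff monomial_def coefficient_map_def)
  then have "coefficient_map ` Rg \<sigma> = (\<lambda>b. monomial G B b \<sigma>) ` (coeff \<sigma> ` Rg \<sigma>)"
    by (simp add: image_image)
  moreover have "coeff \<sigma> ` Rg \<sigma> = carrier B"
    using s coeff_closed coeff_mon mon_in by (force simp: image_iff)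
  ultimately show ?thesis using T.twisted_component_eq[OF s] by simp
qed

lemma coefficient_map_graded_iso:
  "coefficient_map \<in> graded_iso G R Rg (twisted_groupoid_ring G B twist) (twisted_component G B)"
proof -
  have "coefficient_map (x \<oplus>\<^bsub>R\<^esub> y)
      = coefficient_map x \<oplus>\<^bsub>twisted_groupoid_ring G B twist\<^esub> coefficient_map y"
    if "x \<in> carrier R" "y \<in> carrier R" for x y
    using coefficient_map_add[OF that]
    by (auto simp: fun_eq_iff twisted_groupoid_ring_def coefficient_map_def)
  moreover have "bij_betw coefficient_map (carrier R) (carrier (twisted_groupoid_ring G B twist))"
    using coefficient_map_carrier coefficient_map_surj
    by (intro bij_betw_imageI inj_on_coefficient_map) (auto simp: image_iff Bex_def)
  ultimately show ?thesis
    unfolding graded_iso_def iso_def hom_def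
    using coefficient_map_carrier coefficient_map_mult image_component by auto
qed

end

section \<open>From a twisted groupoid ring to invertible elements\<close>

lemma (in object_twist) twist_inverse:
  "composable G \<sigma> \<tau> \<Longrightarrow> \<exists>c\<in>carrier B. c \<otimes>\<^bsub>B\<^esub> \<beta> \<sigma> \<tau> = \<one>\<^bsub>B\<^esub>"
  using twist_unit[of \<sigma> \<tau>] by (auto simp: Units_def ring_center_def)

text \<open>The cocycle identity for the triple \<sigma>, \<open>ginv G \<sigma>\<close>, \<sigma>,
  in which the other two factors are 1 by normalization. It lets one inverse of the twist serve on
  both sides of \<open>u \<sigma>\<close>.\<close>

lemma (in object_twist) twist_ginv:
  assumes s: "\<sigma> \<in> carrier G"
  shows "\<beta> (ginv G \<sigma>) \<sigma> = \<beta> \<sigma> (ginv G \<sigma>)"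
proof -
  have c: "composable G \<sigma> (ginv G \<sigma>)" "composable G (ginv G \<sigma>) \<sigma>"
    using s by (auto simp: composable_def ginv_closed source_ginv target_ginv)
  show ?thesis
    using twist_cocycle[OF c] s twist_closed[OF c(1)] twist_closed[OF c(2)]
    by (simp add: comp_ginv ginv_comp twist_source twist_target)
qed

text \<open>The isomorphism starts at R, so monomials are pulled back along it and all computations
  take place in R, where the identities at the objects are available.\<close>

locale twisted_presentation = object_unital_ring G R Rg + T: object_twist G B \<beta>
  for G :: "('g, 'm) category_struct_scheme" (structure)
    and R :: "('r, 'n) ring_scheme" (structure)
    and Rg :: "'g \<Rightarrow> 'r set"
    and B :: "('b, 'k) ring_scheme"
    and \<beta> :: "'g \<Rightarrow> 'g \<Rightarrow> 'b" +
  fixes h :: "'r \<Rightarrow> 'g \<Rightarrow> 'b"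
  assumes h: "h \<in> graded_iso G R Rg (twisted_groupoid_ring G B \<beta>) (twisted_component G B)"
begin

section \<open>Monomials pulled back to R\<close>

lemma h_mult: "\<lbrakk>x \<in> carrier R; y \<in> carrier R\<rbrakk>
    \<Longrightarrow> h (x \<otimes>\<^bsub>R\<^esub> y) = h x \<otimes>\<^bsub>twisted_groupoid_ring G B \<beta>\<^esub> h y"
  and h_add: "\<lbrakk>x \<in> carrier R; y \<in> carrier R\<rbrakk>
    \<Longrightarrow> h (x \<oplus>\<^bsub>R\<^esub> y) = h x \<oplus>\<^bsub>twisted_groupoid_ring G B \<beta>\<^esub> h y"
  and h_inj: "inj_on h (carrier R)"
  and h_component: "\<sigma> \<in> carrier G \<Longrightarrow> h ` Rg \<sigma> = twisted_component G B \<sigma>"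
  using h by (auto simp: graded_iso_def iso_def hom_def bij_betw_def)

text \<open>The preimage is sought in the component, so that its degree comes with the choice.
  Injectivity of h on R makes it the only preimage in R.\<close>

definition term_at :: "'b \<Rightarrow> 'g \<Rightarrow> 'r" where
  "term_at b \<sigma> = inv_into (Rg \<sigma>) h (monomial G B b \<sigma>)"

lemma
  assumes "\<sigma> \<in> carrier G" "b \<in> carrier B"
  shows term_at_in: "term_at b \<sigma> \<in> Rg \<sigma>" and h_term_at: "h (term_at b \<sigma>) = monomial G B b \<sigma>"
proof -
  have "monomial G B b \<sigma> \<in> h ` Rg \<sigma>"
    using assms by (simp add: h_component T.twisted_component_eq)
  then show "term_at b \<sigma> \<in> Rg \<sigma>" "h (term_at b \<sigma>) = monomial G B b \<sigma>"
    unfolding term_at_def by (simp_all add: inv_into_into f_inv_into_f)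
qed

lemma term_at_carrier: "\<lbrakk>\<sigma> \<in> carrier G; b \<in> carrier B\<rbrakk> \<Longrightarrow> term_at b \<sigma> \<in> carrier R"
  by (rule component_carrier[OF _ term_at_in])

lemma term_at_eqI:
  assumes "\<sigma> \<in> carrier G" "b \<in> carrier B" "x \<in> carrier R" "h x = monomial G B b \<sigma>"
  shows "x = term_at b \<sigma>"
  using inj_onD[OF h_inj, of x "term_at b \<sigma>"] assms by (simp add: h_term_at term_at_carrier)

lemma term_at_surj:
  assumes "\<sigma> \<in> carrier G" "x \<in> Rg \<sigma>"
  shows "\<exists>b\<in>carrier B. x = term_at b \<sigma>"
proof -
  have "h x \<in> twisted_component G B \<sigma>" 
    unfolding h_component[OF assms(1), symmetric] using assms(2) by (rule imageI)
  then obtain b where "b \<in> carrier B" "h x = monomial G B b \<sigma>"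
    using T.twisted_component_eq[OF assms(1)] by auto
  then show ?thesis using term_at_eqI assms component_carrier[OF assms] by (intro bexI[of _ b])
qed

lemma term_at_inject:
  assumes "\<sigma> \<in> carrier G" "b \<in> carrier B" "c \<in> carrier B" "term_at b \<sigma> = term_at c \<sigma>"
  shows "b = c"
proof -
  have "monomial G B b \<sigma> \<sigma> = monomial G B c \<sigma> \<sigma>"
    using h_term_at[OF assms(1,2)] h_term_at[OF assms(1,3)] assms(4) by simp
  then show ?thesis using assms(1) by (simp add: monomial_def)
qed

lemma term_at_add:
  assumes "\<sigma> \<in> carrier G" "b \<in> carrier B" "c \<in> carrier B"
  shows "term_at (b \<oplus>\<^bsub>B\<^esub> c) \<sigma> = term_at b \<sigma> \<oplus>\<^bsub>R\<^esub> term_at c \<sigma>"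
proof (rule term_at_eqI[symmetric])
  have "h (term_at b \<sigma> \<oplus>\<^bsub>R\<^esub> term_at c \<sigma>)
      = monomial G B b \<sigma> \<oplus>\<^bsub>twisted_groupoid_ring G B \<beta>\<^esub> monomial G B c \<sigma>"
    using assms by (simp add: h_add h_term_at term_at_carrier)
  also have "\<dots> = monomial G B (b \<oplus>\<^bsub>B\<^esub> c) \<sigma>"
    using assms by (auto simp: twisted_groupoid_ring_def monomial_def fun_eq_iff)
  finally show "h (term_at b \<sigma> \<oplus>\<^bsub>R\<^esub> term_at c \<sigma>) = monomial G B (b \<oplus>\<^bsub>B\<^esub> c) \<sigma>" .
qed (use assms term_at_carrier in simp_all)

lemma term_at_mult:
  assumes st: "composable G \<sigma> \<tau>" and bc: "b \<in> carrier B" "c \<in> carrier B"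
  shows "term_at b \<sigma> \<otimes>\<^bsub>R\<^esub> term_at c \<tau> = term_at (b \<otimes>\<^bsub>B\<^esub> c \<otimes>\<^bsub>B\<^esub> \<beta> \<sigma> \<tau>) (\<sigma> \<cdot>\<^bsub>G\<^esub> \<tau>)"
proof (rule term_at_eqI)
  have s: "\<sigma> \<in> carrier G" "\<tau> \<in> carrier G" using st by (auto simp: composable_def)
  show "\<sigma> \<cdot>\<^bsub>G\<^esub> \<tau> \<in> carrier G" using st by (simp add: composable_def comp_closed)
  show "b \<otimes>\<^bsub>B\<^esub> c \<otimes>\<^bsub>B\<^esub> \<beta> \<sigma> \<tau> \<in> carrier B" using bc T.twist_closed[OF st] by simp
  show "term_at b \<sigma> \<otimes>\<^bsub>R\<^esub> term_at c \<tau> \<in> carrier R" using s bc by (simp add: m_closed term_at_carrier)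
  show "h (term_at b \<sigma> \<otimes>\<^bsub>R\<^esub> term_at c \<tau>)
      = monomial G B (b \<otimes>\<^bsub>B\<^esub> c \<otimes>\<^bsub>B\<^esub> \<beta> \<sigma> \<tau>) (\<sigma> \<cdot>\<^bsub>G\<^esub> \<tau>)"
    using st s bc by (simp add: h_mult h_term_at term_at_carrier T.monomial_mult)
qed

text \<open>The left factor has an identity as its degree, so normalization removes the twist. At an
  object this is multiplicativity of the copy of B.\<close>

lemma term_at_target_mult:
  assumes "\<sigma> \<in> carrier G" "b \<in> carrier B" "c \<in> carrier B"
  shows "term_at b (target G \<sigma>) \<otimes>\<^bsub>R\<^esub> term_at c \<sigma> = term_at (b \<otimes>\<^bsub>B\<^esub> c) \<sigma>"
  using term_at_mult[of "target G \<sigma>" \<sigma> b c] assms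
  by (simp add: composable_def target_closed source_target T.twist_target target_comp_self)

lemma term_at_source_mult:
  assumes "\<sigma> \<in> carrier G" "b \<in> carrier B" "c \<in> carrier B"
  shows "term_at b \<sigma> \<otimes>\<^bsub>R\<^esub> term_at c (source G \<sigma>) = term_at (b \<otimes>\<^bsub>B\<^esub> c) \<sigma>"
  using term_at_mult[of \<sigma> "source G \<sigma>" b c] assms
  by (simp add: composable_def source_closed target_source T.twist_source comp_source)

section \<open>The copies of B and the object invertible elements\<close>

lemma term_at_one:
  assumes e: "e \<in> objects G"
  shows "term_at \<one>\<^bsub>B\<^esub> e = local_one e"
proof (rule local_one_eqI[symmetric, OF e])
  note ec = objects_closed[OF e]
  show "term_at \<one>\<^bsub>B\<^esub> e \<in> Rg e" using ec by (simp add: term_at_in)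
  fix x assume "x \<in> Rg e"
  from term_at_surj[OF ec this] obtain b where "b \<in> carrier B" "x = term_at b e" ..
  then show "term_at \<one>\<^bsub>B\<^esub> e \<otimes>\<^bsub>R\<^esub> x = x"
    using term_at_target_mult[OF ec T.one_closed] by (simp add: target_object[OF e])
qed

lemma term_at_ring_iso:
  assumes e: "e \<in> objects G"
  shows "(\<lambda>b. term_at b e) \<in> ring_iso B (subring_on R (Rg e))"
proof -
  note ec = objects_closed[OF e]
  have "bij_betw (\<lambda>b. term_at b e) (carrier B) (Rg e)"
    unfolding bij_betw_def
    using term_at_inject[OF ec] term_at_in[OF ec] term_at_surj[OF ec]
    by (auto simp: inj_on_def image_iff)
  moreover have "(\<lambda>b. term_at b e) \<in> ring_hom B (subring_on R (Rg e))"
    using ec e term_at_target_mult[OF ec]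
    by (intro ring_hom_memI)
      (simp_all add: subring_on_def term_at_in term_at_add term_at_one target_object)
  ultimately show ?thesis by (simp add: ring_iso_def subring_on_def)
qed

text \<open>The inverse of \<open>u\<^sub>\<sigma>\<close> is \<open>c u\<^sub>\<tau>\<close> with \<open>\<tau> = ginv G \<sigma>\<close> and \<open>c\<close>
  the inverse of \<open>\<beta> \<sigma> (ginv G \<sigma>) = \<beta> (ginv G \<sigma>) \<sigma>\<close>.\<close>

lemma object_invertible_term_at:
  assumes s: "\<sigma> \<in> carrier G"
  shows "object_invertible G R Rg \<sigma> (term_at \<one>\<^bsub>B\<^esub> \<sigma>)"
proof -
  have comp: "composable G \<sigma> (ginv G \<sigma>)" "composable G (ginv G \<sigma>) \<sigma>"
    using s by (auto simp: composable_def ginv_closed source_ginv target_ginv)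
  obtain c where c: "c \<in> carrier B" "c \<otimes>\<^bsub>B\<^esub> \<beta> \<sigma> (ginv G \<sigma>) = \<one>\<^bsub>B\<^esub>"
    using T.twist_inverse[OF comp(1)] by blast
  show ?thesis
    unfolding object_invertible_def
  proof (intro conjI bexI)
    show "term_at \<one>\<^bsub>B\<^esub> \<sigma> \<otimes>\<^bsub>R\<^esub> term_at c (ginv G \<sigma>) = local_one (target G \<sigma>)"
      using term_at_mult[OF comp(1) T.one_closed c(1)] c s
      by (simp add: comp_ginv term_at_one target_in_objects)
    show "term_at c (ginv G \<sigma>) \<otimes>\<^bsub>R\<^esub> term_at \<one>\<^bsub>B\<^esub> \<sigma> = local_one (source G \<sigma>)"
      using term_at_mult[OF comp(2) c(1) T.one_closed] c s
      by (simp add: ginv_comp term_at_one source_in_objects T.twist_ginv)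
  qed (use s c in \<open>simp_all add: term_at_in ginv_closed\<close>)
qed

text \<open>Both products equal \<open>term_at b \<sigma>\<close>, since one factor has coefficient
  1 and no twist appears next to an identity degree.\<close>

lemma term_at_commute:
  assumes "\<sigma> \<in> carrier G" "b \<in> carrier B"
  shows "term_at b (target G \<sigma>) \<otimes>\<^bsub>R\<^esub> term_at \<one>\<^bsub>B\<^esub> \<sigma> = term_at \<one>\<^bsub>B\<^esub> \<sigma> \<otimes>\<^bsub>R\<^esub> term_at b (source G \<sigma>)"
  using assms by (simp add: term_at_target_mult term_at_source_mult)

end

section \<open>The characterization\<close>

text \<open>The field with two elements, with zero x and one y. It provides a non-zero ring on the
  type of coefficients when the groupoid is empty.\<close>

lemma ring_of_two_elements:
  assumes "x \<noteq> y"
  shows "ring \<lparr>carrier = {x, y}, mult = (\<lambda>a b. if a = y \<and> b = y then y else x), one = y,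
    zero = x, add = (\<lambda>a b. if a = b then x else y)\<rparr>"
  by (rule ringI, rule abelian_groupI) (use assms in \<open>auto intro!: monoidI\<close>)

theorem proposition23:
  fixes G :: "'g category_struct"
    and R :: "'r ring"
    and Rg :: "'g \<Rightarrow> 'r set"
  assumes "object_unital_ring G R Rg"
    and "\<And>e. e \<in> objects G \<Longrightarrow> unit_of R (Rg e) \<noteq> \<zero>\<^bsub>R\<^esub>"
    and "\<exists>x y :: 'b. x \<noteq> y"
  shows "(\<exists>(B :: 'b ring) \<beta> h.
            object_twist G B \<beta> \<and>
            h \<in> graded_iso G R Rg (twisted_groupoid_ring G B \<beta>) (twisted_component G B))
     \<longleftrightarrow>
         (\<exists>(B :: 'b ring) copy.
            ring B \<and>
            (\<forall>e\<in>objects G. copy e \<in> ring_iso B (subring_on R (Rg e))) \<and>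
            (\<forall>\<sigma>\<in>carrier G. \<exists>u. object_invertible G R Rg \<sigma> u \<and>
               (\<forall>b\<in>carrier B. copy (target G \<sigma>) b \<otimes>\<^bsub>R\<^esub> u = u \<otimes>\<^bsub>R\<^esub> copy (source G \<sigma>) b)))"
    (is "?twisted \<longleftrightarrow> (\<exists>B copy. ?copies B copy)")
proof
  interpret object_unital_ring G R Rg by fact
  {
    assume ?twisted
    then obtain B :: "'b ring" and \<beta> h where "object_twist G B \<beta>"
      and "h \<in> graded_iso G R Rg (twisted_groupoid_ring G B \<beta>) (twisted_component G B)"
      by blast
    then interpret P: twisted_presentation G R Rg B \<beta> h
      by (intro twisted_presentation.intro twisted_presentation_axioms.intro assms(1))
    have "?copies B (\<lambda>e b. P.term_at b e)"
      using P.T.ring_axioms P.term_at_ring_iso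
    proof (intro conjI ballI)
      fix \<sigma> assume "\<sigma> \<in> carrier G"
      then show "\<exists>u. object_invertible G R Rg \<sigma> u \<and>
          (\<forall>b\<in>carrier B. P.term_at b (target G \<sigma>) \<otimes>\<^bsub>R\<^esub> u = u \<otimes>\<^bsub>R\<^esub> P.term_at b (source G \<sigma>))"
        using P.object_invertible_term_at P.term_at_commute
        by (intro exI[of _ "P.term_at \<one>\<^bsub>B\<^esub> \<sigma>"]) simp
    qed
    then show "\<exists>B copy. ?copies B copy" by (intro exI)
  }
  assume "\<exists>B copy. ?copies B copy"
  then obtain B0 :: "'b ring" and copy where B0: "?copies B0 copy" by blast
  \<comment> \<open>Only for the empty groupoid can the given ring be zero, and then any ring will do.\<close>
  obtain B :: "'b ring" where B: "?copies B copy" and nonzero: "\<one>\<^bsub>B\<^esub> \<noteq> \<zero>\<^bsub>B\<^esub>"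
  proof (cases "carrier G = {}")
    case True
    obtain x y :: 'b where xy: "x \<noteq> y" using assms(3) by blast
    have "objects G = {}" using True by (simp add: objects_def)
    with True ring_of_two_elements[OF xy] show ?thesis
      using xy by (intro that[OF conjI]) auto
  next
    case False
    then obtain \<sigma> where "\<sigma> \<in> carrier G" by blast
    then have e: "source G \<sigma> \<in> objects G" by (rule source_in_objects)
    \<comment> \<open>A copy at any object sends zero and one of \<open>B0\<close> to zero and the
      identity of that component, which differ by assumption. So \<open>B0\<close> is itself
      non-zero.\<close>
    have hom: "copy (source G \<sigma>) \<in> ring_hom B0 (subring_on R (Rg (source G \<sigma>)))"
      using B0 e by (auto simp: ring_iso_def)
    have "copy (source G \<sigma>) \<zero>\<^bsub>B0\<^esub> = \<zero>\<^bsub>R\<^esub>" "copy (source G \<sigma>) \<one>\<^bsub>B0\<^esub> = local_one (source G \<sigma>)"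
      using ring_hom_zero[OF hom] ring_hom_one[OF hom] B0 unital_component[OF e]
      by (simp_all add: subring_on_def)
    then have "\<one>\<^bsub>B0\<^esub> \<noteq> \<zero>\<^bsub>B0\<^esub>" using assms(2)[OF e] by auto
    then show ?thesis using that B0 by blast
  qed
  \<comment> \<open>Taking the identity of \<open>R\<^sub>e\<close> as \<open>u\<^sub>e\<close> at the objects normalizes the twist.\<close>
  have "\<exists>u v. u \<in> Rg \<sigma> \<and> v \<in> Rg (ginv G \<sigma>) \<and> u \<otimes>\<^bsub>R\<^esub> v = local_one (target G \<sigma>) \<and>
      v \<otimes>\<^bsub>R\<^esub> u = local_one (source G \<sigma>) \<and>
      (\<forall>b\<in>carrier B. copy (target G \<sigma>) b \<otimes>\<^bsub>R\<^esub> u = u \<otimes>\<^bsub>R\<^esub> copy (source G \<sigma>) b) \<and>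
      (\<sigma> \<in> objects G \<longrightarrow> u = local_one \<sigma>)" if s: "\<sigma> \<in> carrier G" for \<sigma>
  proof (cases "\<sigma> \<in> objects G")
    case True
    have "copy \<sigma> b \<in> Rg \<sigma>" if "b \<in> carrier B" for b
      using B True that by (auto simp: ring_iso_def ring_hom_def subring_on_def)
    then have "copy \<sigma> b \<otimes>\<^bsub>R\<^esub> local_one \<sigma> = local_one \<sigma> \<otimes>\<^bsub>R\<^esub> copy \<sigma> b" if "b \<in> carrier B" for b
      using unit_left[OF s, of "copy \<sigma> b"] unit_right[OF s, of "copy \<sigma> b"] that
      by (simp add: source_object[OF True] target_object[OF True])
    then show ?thesis
      using object_invertible_local_one[OF True] local_one_in[OF True]
      by (auto simp: object_invertible_def source_object[OF True] target_object[OF True])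
  next
    case False
    then show ?thesis using B s unfolding object_invertible_def by metis
  qed
  then obtain u v where uv: "\<And>\<sigma>. \<sigma> \<in> carrier G \<Longrightarrow>
      u \<sigma> \<in> Rg \<sigma> \<and> v \<sigma> \<in> Rg (ginv G \<sigma>) \<and> u \<sigma> \<otimes>\<^bsub>R\<^esub> v \<sigma> = local_one (target G \<sigma>) \<and>
      v \<sigma> \<otimes>\<^bsub>R\<^esub> u \<sigma> = local_one (source G \<sigma>) \<and>
      (\<forall>b\<in>carrier B. copy (target G \<sigma>) b \<otimes>\<^bsub>R\<^esub> u \<sigma> = u \<sigma> \<otimes>\<^bsub>R\<^esub> copy (source G \<sigma>) b) \<and>
      (\<sigma> \<in> objects G \<longrightarrow> u \<sigma> = local_one \<sigma>)"
    by metis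
  interpret C: object_unital_copies G R Rg B copy u v
  proof (intro object_unital_copies.intro object_unital_copies_axioms.intro assms(1))
    show "ring B" using B by blast
    show "copy e \<in> ring_iso B (subring_on R (Rg e))" if "e \<in> objects G" for e
      using B that by blast
    show "u e = local_one e" if "e \<in> objects G" for e
      using uv[of e] that by (simp add: objects_closed)
  qed (use uv nonzero in simp_all)
  show ?twisted by (intro exI) (rule conjI[OF C.object_twist_twist C.coefficient_map_graded_iso])
qed

end
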